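(* Let $1 \leq \delta \leq 2$. There are an absolute constant $\alpha>1$ and a sequence $(d_n)_{n\in\mathbb{N}}$ of positive real numbers with $d_n \to 1$ as $n \to \infty$ such that the following holds: for every $n \in \mathbb{N}$ and every (possibly infinite) family $\mathcal{H}=\{ H_i : i\in I\}$ of closed half-spaces in $\mathbb{R}^n$ of the form $$H_i = \{x \in \mathbb{R}^n : \langle x, v_i\rangle \leq 1\}, \qquad v_i\in\mathbb{R}^n,$$ with $\operatorname{vol}\left(\bigcap_{i\in I}H_i\right)=1$, there exist $s \leq \alpha n^{\delta}$ and indices $i_1, \dots, i_s \in I$ such that $$\operatorname{vol}(H_{i_1}\cap \cdots \cap H_{i_s})^{1/n} \leq d_n\, n^{\frac{3}{2}-\frac{\delta}{2}}.$$
   Context: $\operatorname{vol}$ denotes $n$-dimensional volume (Lebesgue measure) in $\mathbb{R}^n$ and $\langle\cdot,\cdot\rangle$ is the standard Euclidean inner product. "Absolute constant" means that $\alpha$ does not depend on $n$, $\delta$, or the family $\mathcal{H}$. The sequence $(d_n)$ does not depend on the family $\mathcal{H}$. *)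

theory Defs
  imports "HOL-Analysis.Analysis"
begin

text \<open>
  The dimension has to be quantified inside the theorem, because the constants must not depend
  on it.  Hence \<open>\<real>\<^sup>n\<close> is represented by the extensional functions on \<open>{..<n}\<close>, which is the
  underlying space of the \<open>n\<close>-fold product of Lebesgue-Borel measure on the line.
\<close>

definition Rn :: "nat \<Rightarrow> (nat \<Rightarrow> real) set" where
  "Rn n = {..<n} \<rightarrow>\<^sub>E UNIV"

definition inner_Rn :: "nat \<Rightarrow> (nat \<Rightarrow> real) \<Rightarrow> (nat \<Rightarrow> real) \<Rightarrow> real" where
  "inner_Rn n x y = (\<Sum>i<n. x i * y i)"

text \<open>
  Volume is valued in \<^typ>\<open>ennreal\<close>, so unbounded sets really have volume \<open>\<infinity>\<close>.  Passing to the
  completed measure is unnecessary, as all sets in question are Borel: see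
  \<open>Inter_halfspaces_measurable\<close> below.
\<close>

definition lborel_Rn :: "nat \<Rightarrow> (nat \<Rightarrow> real) measure" where
  "lborel_Rn n = (\<Pi>\<^sub>M i\<in>{..<n}. lborel)"

definition vol :: "nat \<Rightarrow> (nat \<Rightarrow> real) set \<Rightarrow> ennreal" where
  "vol n A = emeasure (lborel_Rn n) A"

text \<open>For \<open>v = 0\<close> this is the whole space.\<close>

definition halfspace :: "nat \<Rightarrow> (nat \<Rightarrow> real) \<Rightarrow> (nat \<Rightarrow> real) set" where
  "halfspace n v = {x \<in> Rn n. inner_Rn n x v \<le> 1}"

lemma space_lborel_Rn: "space (lborel_Rn n) = Rn n"
  by (simp add: lborel_Rn_def Rn_def space_PiM)

lemma halfspace_measurable: "halfspace n v \<in> sets (lborel_Rn n)"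
proof -
  have "(\<lambda>x. inner_Rn n x v) \<in> borel_measurable (lborel_Rn n)"
    unfolding inner_Rn_def lborel_Rn_def by measurable
  then have "{x \<in> space (lborel_Rn n). inner_Rn n x v \<le> 1} \<in> sets (lborel_Rn n)"
    by measurable
  then show ?thesis
    by (simp add: halfspace_def space_lborel_Rn)
qed

lemma Inter_halfspaces_measurable:
  assumes "\<And>H. H \<in> \<H> \<Longrightarrow> \<exists>v. H = halfspace n v"
  shows "Rn n \<inter> \<Inter>\<H> \<in> sets (lborel_Rn n)"
proof -
  define V where "V = {v. halfspace n v \<in> \<H>}"
  define U where "U v = {x. inner_Rn n x v > 1}" for v
  have "open (U v)" for v
    unfolding U_def inner_Rn_def
    by (intro open_Collect_less continuous_intros continuous_on_product_coordinates)
  then have "\<And>S. S \<in> U ` V \<Longrightarrow> open S"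
    by auto
  from Lindelof[OF this]
  obtain \<F> where F: "\<F> \<subseteq> U ` V" "countable \<F>" "\<Union>\<F> = \<Union>(U ` V)"
    by metis
  obtain W where W: "countable W" "\<F> = U ` W"
    using F(1,2) countable_subset_image[of \<F> U V] by metis
  have "x \<in> \<Inter>\<H> \<longleftrightarrow> x \<notin> \<Union>(U ` V)" if "x \<in> Rn n" for x
  proof -
    have "x \<in> \<Inter>\<H> \<longleftrightarrow> (\<forall>v\<in>V. x \<in> halfspace n v)"
      using assms unfolding V_def by blast
    also have "\<dots> \<longleftrightarrow> x \<notin> \<Union>(U ` V)"
      using that by (simp add: U_def halfspace_def not_less)
    finally show ?thesis .
  qed
  then have "Rn n \<inter> \<Inter>\<H> = Rn n - \<Union>(U ` V)"
    by blast
  also have "\<dots> = Rn n - \<Union>(U ` W)"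
    using F W by simp
  also have "\<dots> = space (lborel_Rn n) - (\<Union>w\<in>W. space (lborel_Rn n) - halfspace n w)"
    unfolding U_def halfspace_def space_lborel_Rn by force
  also have "\<dots> \<in> sets (lborel_Rn n)"
    using W(1) by (intro sets.compl_sets sets.countable_UN'') (auto intro: halfspace_measurable)
  finally show ?thesis .
qed

end

theory Submission
  imports Defs "HOL-Probability.Probability_Measure" "HOL-Real_Asymp.Real_Asymp"
begin

text \<open>
  Among the subfamilies of at most \<open>s\<close> half-spaces take one whose intersection \<open>Q\<close> has nearly
  minimal volume.  Dropping a suitable member enlarges \<open>Q\<close> by a factor of at most
  \<open>1 + \<theta>\<close>, \<open>\<theta> = 8 n / (s - 8 n)\<close>: one of the cones over the facets with apex the centroid \<open>z\<close> has
  at most the average volume, and by Brunn-Minkowski the region beyond its facet is small as well.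
  By minimality, no half-space \<open>\<langle>x, v\<rangle> \<le> 1\<close> of the whole family can then cut off more than a
  fraction \<open>2 \<theta>\<close> of \<open>Q\<close>.

  For \<open>x\<close> uniform in \<open>Q\<close>, the variable \<open>t = \<langle>x - z, v\<rangle>\<close> has mean 0 and log-concave tails.  If it
  exceeds \<open>\<tau> = 1 - \<langle>z, v\<rangle>\<close> only with probability \<open>p\<close>, then \<open>E t\<^sup>2 \<le> (1 + 20 p) \<tau>\<^sup>2\<close>, as for
  the exponential law, where \<open>E (\<tau> - t)\<^sup>2 = 2 \<tau>\<^sup>2\<close> and \<open>p = 0\<close>.  In coordinates in which \<open>Q\<close> is
  isotropic this says that \<open>P\<close>, the intersection of the whole family, contains the ball around
  \<open>z\<close> of radius \<open>(1 + 40 \<theta>)\<close> to the power \<open>-1/2\<close>, whereas \<open>E |x - z|\<^sup>2 = n\<close> puts a share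
  \<open>1 / (n + 1)\<close> of \<open>Q\<close> into the ball of radius \<open>sqrt (n + 1)\<close>.  The volume of the unit
  ball cancels, so the volume ratio of \<open>Q\<close> and \<open>P\<close> is at most
  \<open>(n + 1) (sqrt (1 + 40 \<theta>) sqrt (n + 1))\<^sup>n\<close>.  With \<open>s\<close> about \<open>201 n\<close> to the power \<open>\<delta>\<close>, \<open>\<theta>\<close>
  is bounded, and it tends to 0 for \<open>\<delta> > 1\<close>; this suffices because the claimed bound exceeds
  \<open>sqrt n\<close> by a power of \<open>n\<close> unless \<open>\<delta> = 2\<close>.
\<close>

section \<open>The Prekopa-Leindler inequality\<close>

text \<open>Fubini for the region under the graph of f. Negative values are harmless:
  \<open>ennreal\<close> sends them to 0 on the left, and the indicator keeps only the levels
  \<open>u \<ge> 0\<close> on the right.\<close>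

lemma nn_integral_layer_cake:
  fixes f :: "'a \<Rightarrow> real"
  assumes "sigma_finite_measure M" and [measurable]: "f \<in> borel_measurable M"
  shows "(\<integral>\<^sup>+x. ennreal (f x) \<partial>M) =
         (\<integral>\<^sup>+u. emeasure M {x\<in>space M. u < f x} * indicator {0..} u \<partial>lborel)"
proof -
  interpret sigma_finite_measure M by fact
  interpret pair_sigma_finite M lborel ..
  have "(\<integral>\<^sup>+x. ennreal (f x) \<partial>M) = (\<integral>\<^sup>+x. (\<integral>\<^sup>+u. indicator {0..<f x} u \<partial>lborel) \<partial>M)"
  proof (intro nn_integral_cong)
    fix x show "ennreal (f x) = (\<integral>\<^sup>+u. indicator {0..<f x} u \<partial>lborel)"
      by (cases "0 \<le> f x") (auto simp: ennreal_neg)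
  qed
  also have "\<dots> = (\<integral>\<^sup>+x. (\<integral>\<^sup>+u. indicator {u. u < f x} u * indicator {0..} u \<partial>lborel) \<partial>M)"
    by (intro nn_integral_cong) (auto simp: indicator_def)
  also have "\<dots> = (\<integral>\<^sup>+u. (\<integral>\<^sup>+x. indicator {u. u < f x} u * indicator {0..} u \<partial>M) \<partial>lborel)"
    by (intro Fubini'[symmetric]) simp
  also have "\<dots> = (\<integral>\<^sup>+u. emeasure M {x\<in>space M. u < f x} * indicator {0..} u \<partial>lborel)"
  proof (intro nn_integral_cong)
    fix u :: real
    have "(\<integral>\<^sup>+x. indicator {u. u < f x} u * indicator {0..} u \<partial>M)
        = (\<integral>\<^sup>+x. indicator {x\<in>space M. u < f x} x * indicator {0..} u \<partial>M)"
      by (intro nn_integral_cong) (auto simp: indicator_def)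
    also have "\<dots> = emeasure M {x\<in>space M. u < f x} * indicator {0..} u"
      by (subst nn_integral_multc) auto
    finally show "(\<integral>\<^sup>+x. indicator {u. u < f x} u * indicator {0..} u \<partial>M) =
      emeasure M {x\<in>space M. u < f x} * indicator {0..} u" .
  qed
  finally show ?thesis .
qed

text \<open>The set is \<open>t + c A\<close>, written as a preimage so that its measurability is
  immediate.\<close>

lemma emeasure_lborel_affine_image:
  fixes c :: real
  assumes [measurable]: "A \<in> sets borel" and c: "c > 0"
  shows "emeasure lborel {x. (x - t) / c \<in> A} = ennreal c * emeasure lborel A"
proof -
  have "emeasure lborel {x. (x - t) / c \<in> A} = (\<integral>\<^sup>+x. indicator A ((x - t) / c) \<partial>lborel)"
  proof -
    have "(\<integral>\<^sup>+x. indicator A ((x - t) / c) \<partial>lborel) =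
        (\<integral>\<^sup>+x. indicator {x. (x - t) / c \<in> A} x \<partial>lborel)"
      by (intro nn_integral_cong) (simp add: indicator_def)
    then show ?thesis by simp
  qed
  also have "\<dots> = ennreal c * (\<integral>\<^sup>+x. indicator A ((t + c * x - t) / c) \<partial>lborel)"
    using c by (subst nn_integral_real_affine[where c=c and t=t]) auto
  also have "\<dots> = ennreal c * emeasure lborel A"
    using c by simp
  finally show ?thesis .
qed

text \<open>Shifting one set by an almost extremal point of the other, in both directions, gives two
  subsets of the sum that overlap in an arbitrarily short interval.\<close>

lemma Brunn_Minkowski_real:
  fixes A B C :: "real set"
  assumes [measurable]: "A \<in> sets borel" "B \<in> sets borel" "C \<in> sets borel"
    and ne: "A \<noteq> {}" "B \<noteq> {}" and bd: "bdd_above A" "bdd_below B"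
    and l: "0 < l" "l < 1"
    and AB: "\<And>a b. a \<in> A \<Longrightarrow> b \<in> B \<Longrightarrow> (1 - l) * a + l * b \<in> C"
  shows "ennreal (1 - l) * emeasure lborel A + ennreal l * emeasure lborel B \<le> emeasure lborel C"
proof (rule ennreal_le_epsilon)
  fix e :: real assume e: "0 < e"
  obtain a0 where a0: "a0 \<in> A" "Sup A - e < a0"
    using less_cSup_iff[OF ne(1) bd(1), of "Sup A - e"] e by auto
  obtain b0 where b0: "b0 \<in> B" "b0 < Inf B + e"
    using cInf_less_iff[OF ne(2) bd(2), of "Inf B + e"] e by auto
  define A' where "A' = {x. (x - l * b0) / (1 - l) \<in> A}"
  define B' where "B' = {x. (x - (1 - l) * a0) / l \<in> B}"
  have [measurable]: "A' \<in> sets borel" "B' \<in> sets borel"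
    unfolding A'_def B'_def by measurable
  have eA: "emeasure lborel A' = ennreal (1 - l) * emeasure lborel A"
    unfolding A'_def using l by (subst emeasure_lborel_affine_image) auto
  have eB: "emeasure lborel B' = ennreal l * emeasure lborel B"
    unfolding B'_def using l by (subst emeasure_lborel_affine_image) auto
  have A'C: "A' \<subseteq> C"
  proof
    fix x assume "x \<in> A'"
    then have "(1 - l) * ((x - l * b0) / (1 - l)) + l * b0 \<in> C"
      using AB b0(1) unfolding A'_def by blast
    then show "x \<in> C" using l by simp
  qed
  have B'C: "B' \<subseteq> C"
  proof
    fix x assume "x \<in> B'"
    then have "(1 - l) * a0 + l * ((x - (1 - l) * a0) / l) \<in> C"
      using AB a0(1) unfolding B'_def by blast
    then show "x \<in> C" using l by simp
  qed
  \<comment> \<open>\<open>A'\<close> lies below q and \<open>B'\<close> above p; since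
    \<open>a0\<close> and \<open>b0\<close> are within e of the extremes,
    \<open>q - p \<le> e\<close>.\<close>
  define p where "p = (1 - l) * a0 + l * Inf B"
  define q where "q = (1 - l) * Sup A + l * b0"
  have "A' \<inter> B' \<subseteq> {p..q}"
  proof
    fix x assume x: "x \<in> A' \<inter> B'"
    have "(x - l * b0) / (1 - l) \<le> Sup A"
      using x bd(1) unfolding A'_def by (auto intro: cSup_upper)
    then have "x \<le> q" using l unfolding q_def by (simp add: pos_divide_le_eq mult.commute)
    moreover have "Inf B \<le> (x - (1 - l) * a0) / l"
      using x bd(2) unfolding B'_def by (auto intro: cInf_lower)
    then have "p \<le> x" using l unfolding p_def by (simp add: pos_le_divide_eq mult.commute)
    ultimately show "x \<in> {p..q}" by simp
  qed
  then have "emeasure lborel (A' \<inter> B') \<le> emeasure lborel {p..q}"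
    by (intro emeasure_mono) auto
  also have "\<dots> \<le> ennreal e"
  proof -
    have "q - p = (1 - l) * (Sup A - a0) + l * (b0 - Inf B)"
      by (simp add: p_def q_def algebra_simps)
    also have "\<dots> \<le> (1 - l) * e + l * e"
      using a0 b0 l by (intro add_mono mult_left_mono) auto
    finally have "q - p \<le> e" by (simp add: algebra_simps)
    then show ?thesis
      by (cases "p \<le> q") (auto simp: ennreal_leI)
  qed
  finally have inter: "emeasure lborel (A' \<inter> B') \<le> ennreal e" .
  have "emeasure lborel A' + emeasure lborel B' = emeasure lborel (A' \<union> B') + emeasure lborel (A' \<inter> B')"
    by (rule emeasure_Un_Int) auto
  also have "\<dots> \<le> emeasure lborel C + ennreal e"
    using A'C B'C inter by (intro add_mono emeasure_mono) auto
  finally show "ennreal (1 - l) * emeasure lborel A + ennreal l * emeasure lborel B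
      \<le> emeasure lborel C + ennreal e"
    by (simp add: eA eB)
qed

lemma integrable_bounded_support:
  fixes f :: "real \<Rightarrow> real"
  assumes [measurable]: "f \<in> borel_measurable borel"
    and "\<And>x. \<bar>f x\<bar> \<le> K" "\<And>x. \<bar>x\<bar> > R \<Longrightarrow> f x = 0"
  shows "integrable lborel f"
proof (rule Bochner_Integration.integrable_bound)
  show "integrable lborel (\<lambda>x. K * indicator {-R..R} x)"
    by (intro integrable_mult_right integrable_real_indicator) (auto simp: emeasure_lborel_Icc_eq)
  have "norm (f x) \<le> norm (K * indicator {-R..R} x)" for x
    using assms(2,3)[of x] by (cases "\<bar>x\<bar> \<le> R") (auto simp: indicator_def abs_le_iff)
  then show "AE x in lborel. norm (f x) \<le> norm (K * indicator {-R..R} x)" by simp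
qed simp

lemma weighted_AM_GM:
  fixes a b :: real
  assumes "0 \<le> a" "0 \<le> b" "0 < l" "l < 1"
  shows "a powr (1 - l) * b powr l \<le> (1 - l) * a + l * b"
  using assms Youngs_inequality_0[of "1 - l" l a b] by (cases "a = 0 \<or> b = 0") auto

text \<open>Scaling f and g to supremum 1 makes both superlevel sets nonempty at every level below
  1, so that \<open>Brunn_Minkowski_real\<close> applies level by level. Integrating over the levels
  gives the inequality with an arithmetic mean, and \<open>weighted_AM_GM\<close> passes to the
  geometric one.\<close>

lemma Prekopa_Leindler_real:
  fixes f g h :: "real \<Rightarrow> real"
  assumes [measurable]: "f \<in> borel_measurable borel" "g \<in> borel_measurable borel"
    and h: "integrable lborel h"
    and f0: "\<And>x. 0 \<le> f x" "\<And>x. f x \<le> K" "\<And>x. \<bar>x\<bar> > R \<Longrightarrow> f x = 0"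
    and g0: "\<And>x. 0 \<le> g x" "\<And>x. g x \<le> K" "\<And>x. \<bar>x\<bar> > R \<Longrightarrow> g x = 0"
    and h0: "\<And>x. 0 \<le> h x"
    and l: "0 < l" "l < 1"
    and fgh: "\<And>x y. f x powr (1 - l) * g y powr l \<le> h ((1 - l) * x + l * y)"
  shows "(\<integral>x. f x \<partial>lborel) powr (1 - l) * (\<integral>x. g x \<partial>lborel) powr l \<le> (\<integral>x. h x \<partial>lborel)"
proof (cases "(\<forall>x. f x = 0) \<or> (\<forall>x. g x = 0)")
  case True
  then have "f = (\<lambda>_. 0) \<or> g = (\<lambda>_. 0)" by auto
  then show ?thesis using h0 by (auto intro!: integral_nonneg)
next
  case False
  have [measurable]: "h \<in> borel_measurable borel" using h by simp
  define F where "F = (SUP x. f x)"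
  define G where "G = (SUP x. g x)"
  have bf: "bdd_above (range f)" and bg: "bdd_above (range g)"
    using f0(2) g0(2) by (auto intro!: bdd_aboveI2)
  have fF: "f x \<le> F" and gG: "g x \<le> G" for x
    unfolding F_def G_def by (auto intro!: cSUP_upper bf bg)
  have F: "F > 0" and G: "G > 0"
    using False f0(1) g0(1) fF gG by (metis less_le_trans order_less_le)+
  define c where "c = F powr (1 - l) * G powr l"
  have c: "c > 0" using F G by (simp add: c_def)
  \<comment> \<open>From level 1 on both sets on the left are empty; below it neither is, and the
    bounded supports of f and g make them bounded.\<close>
  have key: "ennreal (1 - l) * emeasure lborel {x. u < f x / F} + ennreal l * emeasure lborel {x. u < g x / G}
      \<le> emeasure lborel {x. u < h x / c}" if u: "u \<ge> 0" for u
  proof (cases "u < 1")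
    case True
    have neA: "{x. u < f x / F} \<noteq> {}"
    proof -
      have "u * F < F" using True F by simp
      then obtain x where "u * F < f x"
        unfolding F_def using less_cSUP_iff[OF _ bf, of "u * Sup (range f)"] by auto
      then show ?thesis using F by (auto simp: field_simps)
    qed
    have neB: "{x. u < g x / G} \<noteq> {}"
    proof -
      have "u * G < G" using True G by simp
      then obtain x where "u * G < g x"
        unfolding G_def using less_cSUP_iff[OF _ bg, of "u * Sup (range g)"] by auto
      then show ?thesis using G by (auto simp: field_simps)
    qed
    have bdA: "bdd_above {x. u < f x / F}"
      using f0(3) u F by (intro bdd_aboveI[of _ R]) (force simp: not_less[symmetric])
    have bdB: "bdd_below {x. u < g x / G}"
      using g0(3) u G by (intro bdd_belowI[of _ "-R"]) (force simp: not_less[symmetric])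
    show ?thesis
    proof (rule Brunn_Minkowski_real[OF _ _ _ neA neB bdA bdB l])
      fix a b assume "a \<in> {x. u < f x / F}" "b \<in> {x. u < g x / G}"
      then have ab: "u * F < f a" "u * G < g b" using F G by (auto simp: field_simps)
      have "u * c = (u * F) powr (1 - l) * (u * G) powr l"
      proof (cases "u = 0")
        case False
        have "(u * F) powr (1 - l) * (u * G) powr l = (u powr (1 - l) * u powr l) * c"
          using u F G by (simp add: c_def powr_mult)
        also have "u powr (1 - l) * u powr l = u"
          using u False by (simp add: powr_add[symmetric])
        finally show ?thesis by simp
      qed auto
      also have "\<dots> < f a powr (1 - l) * g b powr l"
        using ab u F G l zero_le_mult_iff[of u F] zero_le_mult_iff[of u G]
        by (intro mult_strict_mono' powr_less_mono2) auto
      also have "\<dots> \<le> h ((1 - l) * a + l * b)" by (rule fgh)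
      finally show "(1 - l) * a + l * b \<in> {x. u < h x / c}" using c by (simp add: field_simps)
    qed measurable
  next
    case False
    have fu: "f x / F \<le> u" "g x / G \<le> u" for x
      using False fF[of x] gG[of x] F G divide_le_eq_1_pos[of F "f x"] divide_le_eq_1_pos[of G "g x"]
      by linarith+
    have "{x. u < f x / F} = {}" "{x. u < g x / G} = {}"
      using fu by (auto simp: not_less dest: order_trans)
    then show ?thesis by simp
  qed
  have fin: "integrable lborel f" "integrable lborel g"
    using f0 g0 by (auto intro!: integrable_bounded_support[where K=K and R=R])
  have lc: "sigma_finite_measure (lborel :: real measure)"
    by (rule lborel.sigma_finite_measure_axioms)
  have "ennreal (1 - l) * (\<integral>\<^sup>+x. ennreal (f x / F) \<partial>lborel) + ennreal l * (\<integral>\<^sup>+x. ennreal (g x / G) \<partial>lborel)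
     = (\<integral>\<^sup>+u. (ennreal (1 - l) * emeasure lborel {x. u < f x / F} +
          ennreal l * emeasure lborel {x. u < g x / G}) * indicator {0..} u \<partial>lborel)"
  proof -
    have "(\<lambda>u. emeasure lborel {x. u < f x / F}) \<in> borel_measurable borel"
         "(\<lambda>u. emeasure lborel {x. u < g x / G}) \<in> borel_measurable borel"
      by measurable
    then show ?thesis
      by (simp add: nn_integral_layer_cake[OF lc] distrib_right nn_integral_add nn_integral_cmult
          mult.assoc)
  qed
  also have "\<dots> \<le> (\<integral>\<^sup>+u. emeasure lborel {x. u < h x / c} * indicator {0..} u \<partial>lborel)"
    using key by (intro nn_integral_mono) (auto simp: indicator_def)
  also have "\<dots> = (\<integral>\<^sup>+x. ennreal (h x / c) \<partial>lborel)"
    by (subst nn_integral_layer_cake[OF lc]) auto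
  finally have 1: "ennreal (1 - l) * (\<integral>\<^sup>+x. ennreal (f x / F) \<partial>lborel) + ennreal l * (\<integral>\<^sup>+x. ennreal (g x / G) \<partial>lborel)
      \<le> (\<integral>\<^sup>+x. ennreal (h x / c) \<partial>lborel)" .
  let ?f = "\<integral>x. f x \<partial>lborel" and ?g = "\<integral>x. g x \<partial>lborel" and ?h = "\<integral>x. h x \<partial>lborel"
  have "(\<integral>\<^sup>+x. ennreal (f x / F) \<partial>lborel) = ennreal (?f / F)"
    using f0(1) F fin by (subst nn_integral_eq_integral) auto
  moreover have "(\<integral>\<^sup>+x. ennreal (g x / G) \<partial>lborel) = ennreal (?g / G)"
    using g0(1) G fin by (subst nn_integral_eq_integral) auto
  moreover have "(\<integral>\<^sup>+x. ennreal (h x / c) \<partial>lborel) = ennreal (?h / c)"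
    using h0 c h by (subst nn_integral_eq_integral) auto
  ultimately have 2: "(1 - l) * (?f / F) + l * (?g / G) \<le> ?h / c"
    using 1 l F G c f0(1) g0(1) h0
    by (simp flip: ennreal_mult ennreal_plus add: integral_nonneg)
  have "(?f / F) powr (1 - l) * (?g / G) powr l \<le> (1 - l) * (?f / F) + l * (?g / G)"
    using l F G f0(1) g0(1) by (intro weighted_AM_GM) (auto intro!: integral_nonneg)
  with 2 have "(?f / F) powr (1 - l) * (?g / G) powr l \<le> ?h / c" by linarith
  moreover have "(?f / F) powr (1 - l) * (?g / G) powr l = ?f powr (1 - l) * ?g powr l / c"
    using F G f0(1) g0(1) by (simp add: c_def powr_divide integral_nonneg)
  ultimately show ?thesis using c by (simp add: field_simps)
qed

section \<open>Boxes, convex combinations and homotheties in \<open>Rn n\<close>\<close>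

definition Box :: "nat \<Rightarrow> real \<Rightarrow> (nat \<Rightarrow> real) set" where
  "Box n R = {x \<in> Rn n. \<forall>i<n. \<bar>x i\<bar> \<le> R}"

text \<open>A convex combination for \<open>0 < r < 1\<close>; for \<open>r > 0\<close> also the
  homothety with centre x and ratio r, applied to y. The restriction to \<open>{..<n}\<close> keeps
  the value extensional.\<close>

definition mix :: "nat \<Rightarrow> real \<Rightarrow> (nat \<Rightarrow> real) \<Rightarrow> (nat \<Rightarrow> real) \<Rightarrow> nat \<Rightarrow> real" where
  "mix n r x y = (\<lambda>i\<in>{..<n}. (1 - r) * x i + r * y i)"

lemma product_sigma_finite_lborel: "product_sigma_finite (\<lambda>_::nat. lborel :: real measure)"
  by (simp add: product_sigma_finite_def lborel.sigma_finite_measure_axioms)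

lemma mix_in_Rn [simp, intro]: "mix n r x y \<in> Rn n"
  by (simp add: mix_def Rn_def)

lemma mix_nth [simp]: "i < n \<Longrightarrow> mix n r x y i = (1 - r) * x i + r * y i"
  by (simp add: mix_def)

lemma inner_Rn_mix: "inner_Rn n (mix n r x y) v = (1 - r) * inner_Rn n x v + r * inner_Rn n y v"
  by (simp add: inner_Rn_def sum_distrib_left sum.distrib[symmetric] algebra_simps)

lemma measurable_coord: "i < n \<Longrightarrow> (\<lambda>x. x i) \<in> borel_measurable (lborel_Rn n)"
  unfolding lborel_Rn_def using measurable_component_singleton[of i "{..<n}" "\<lambda>_. lborel"] by simp

lemma measurable_inner_Rn [measurable]: "(\<lambda>x. inner_Rn n x v) \<in> borel_measurable (lborel_Rn n)"
  unfolding inner_Rn_def lborel_Rn_def by measurable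

lemma measurable_mix: "mix n r z \<in> measurable (lborel_Rn n) (lborel_Rn n)"
  unfolding mix_def lborel_Rn_def
  by (intro measurable_restrict borel_measurable_add borel_measurable_times)
     (auto intro!: measurable_component_singleton)

lemma Box_eq: "Box n R = (\<Pi>\<^sub>E i\<in>{..<n}. {-R..R})"
proof (rule set_eqI)
  fix x :: "nat \<Rightarrow> real"
  have "\<bar>x i\<bar> \<le> R \<longleftrightarrow> x i \<in> {-R..R}" for i by (simp add: abs_le_iff minus_le_iff conj_commute)
  then show "x \<in> Box n R \<longleftrightarrow> x \<in> (\<Pi>\<^sub>E i\<in>{..<n}. {-R..R})"
    unfolding Box_def Rn_def PiE_iff mem_Collect_eq by blast
qed

lemma sets_Box [measurable]: "Box n R \<in> sets (lborel_Rn n)"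
  unfolding Box_eq lborel_Rn_def by (rule sets_PiM_I_finite) simp_all

lemma emeasure_Box_finite: "emeasure (lborel_Rn n) (Box n R) < \<infinity>"
proof -
  interpret product_sigma_finite "\<lambda>_::nat. lborel :: real measure"
    by (rule product_sigma_finite_lborel)
  have "emeasure (lborel_Rn n) (Box n R) = (\<Prod>i<n. emeasure lborel {-R..R})"
    unfolding lborel_Rn_def Box_eq by (simp add: emeasure_PiM)
  also have "\<dots> < \<infinity>"
    by (cases "R \<ge> 0") (auto simp: ennreal_power[symmetric] power_less_top_ennreal)
  finally show ?thesis .
qed

text \<open>The image measure under the homothety, rescaled by \<open>r ^ n\<close>, agrees with the
  product measure on product sets, coordinate by coordinate; these sets determine the
  measure.\<close>

lemma vol_mix:
  assumes r: "r > 0" and A: "A \<in> sets (lborel_Rn n)"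
  shows "ennreal (r ^ n) * vol n {x \<in> Rn n. mix n r z x \<in> A} = vol n A"
proof -
  interpret product_sigma_finite "\<lambda>_::nat. lborel :: real measure"
    by (rule product_sigma_finite_lborel)
  define P where "P = scale_measure (ennreal (r ^ n)) (distr (lborel_Rn n) (lborel_Rn n) (mix n r z))"
  have emP: "emeasure P A = ennreal (r ^ n) * vol n {x \<in> Rn n. mix n r z x \<in> A}"
    if "A \<in> sets (lborel_Rn n)" for A
    using that measurable_mix
    by (simp add: P_def emeasure_distr vol_def space_lborel_Rn vimage_def Int_def conj_commute)
  have "P = (\<Pi>\<^sub>M i\<in>{..<n}. lborel)"
  proof (rule PiM_eqI)
    show "sets P = sets (\<Pi>\<^sub>M i\<in>{..<n}. lborel)" by (simp add: P_def lborel_Rn_def)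
    fix A :: "nat \<Rightarrow> real set" assume A: "\<And>i. i \<in> {..<n} \<Longrightarrow> A i \<in> sets lborel"
    have sA: "Pi\<^sub>E {..<n} A \<in> sets (lborel_Rn n)"
      unfolding lborel_Rn_def by (rule sets_PiM_I_finite) (use A in simp_all)
    define B where "B i = {t. (t - (- ((1 - r) * z i / r))) / (1 / r) \<in> A i}" for i
    have B: "B i \<in> sets lborel" if "i < n" for i
    proof -
      have [measurable]: "A i \<in> sets borel" using A that by simp
      show ?thesis unfolding B_def by measurable
    qed
    have eB: "ennreal r * emeasure lborel (B i) = emeasure lborel (A i)" if "i < n" for i
      unfolding B_def using A that r
      by (subst emeasure_lborel_affine_image) (auto simp: mult.assoc[symmetric] ennreal_mult[symmetric])
    have "(t - (- ((1 - r) * c / r))) / (1 / r) = (1 - r) * c + r * t" for t c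
      using r by (simp add: distrib_left distrib_right)
    then have "{x \<in> Rn n. mix n r z x \<in> Pi\<^sub>E {..<n} A} = Pi\<^sub>E {..<n} B"
      unfolding B_def by (auto simp: Rn_def PiE_iff mix_def extensional_def)
    then have "emeasure P (Pi\<^sub>E {..<n} A) = ennreal (r ^ n) * (\<Prod>i<n. emeasure lborel (B i))"
      using emP[OF sA] emeasure_PiM[of "{..<n}" B] B by (simp add: vol_def lborel_Rn_def)
    also have "\<dots> = (\<Prod>i<n. ennreal r * emeasure lborel (B i))"
      using r by (simp add: prod.distrib ennreal_power)
    also have "\<dots> = (\<Prod>i<n. emeasure lborel (A i))"
      using eB by (intro prod.cong) auto
    finally show "emeasure P (Pi\<^sub>E {..<n} A) = (\<Prod>i<n. emeasure lborel (A i))" .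
  qed simp
  then show ?thesis using emP[OF A] by (simp add: vol_def lborel_Rn_def)
qed

text \<open>All later volume comparisons that shrink a set towards a point z go through
  this.\<close>

lemma vol_mix_le:
  assumes r: "r > 0" and A: "A \<in> sets (lborel_Rn n)"
    and B: "B \<subseteq> Rn n" "\<And>x. x \<in> B \<Longrightarrow> mix n r z x \<in> A"
  shows "ennreal (r ^ n) * vol n B \<le> vol n A"
proof -
  have "{x \<in> Rn n. mix n r z x \<in> A} = mix n r z -` A \<inter> space (lborel_Rn n)"
    by (auto simp: space_lborel_Rn)
  also have "\<dots> \<in> sets (lborel_Rn n)"
    using A measurable_mix by (rule measurable_sets[rotated])
  finally have "vol n B \<le> vol n {x \<in> Rn n. mix n r z x \<in> A}"
    unfolding vol_def using B by (intro emeasure_mono) auto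
  then show ?thesis
    unfolding vol_mix[OF r A, of z, symmetric] by (intro mult_left_mono) auto
qed

section \<open>Prekopa-Leindler and Brunn-Minkowski in dimension n\<close>

text \<open>A class that contains the indicators of bounded measurable sets and is closed under
  integrating out the last coordinate, up to a change of K. Its members are integrable, so the
  induction on the dimension meets no infinite integral.\<close>

definition box_supported :: "nat \<Rightarrow> real \<Rightarrow> real \<Rightarrow> ((nat \<Rightarrow> real) \<Rightarrow> real) \<Rightarrow> bool" where
  "box_supported n R K f \<longleftrightarrow> f \<in> borel_measurable (lborel_Rn n) \<and>
     (\<forall>x\<in>Rn n. 0 \<le> f x \<and> f x \<le> K) \<and> (\<forall>x\<in>Rn n - Box n R. f x = 0)"

lemma box_supported_integrable:
  assumes "box_supported n R K f" shows "integrable (lborel_Rn n) f"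
proof (rule Bochner_Integration.integrable_bound)
  show "integrable (lborel_Rn n) (\<lambda>x. K * indicator (Box n R) x)"
    using emeasure_Box_finite by (intro integrable_mult_right integrable_real_indicator) auto
  show "AE x in lborel_Rn n. norm (f x) \<le> norm (K * indicator (Box n R) x)"
    using assms by (intro AE_I2) (force simp: box_supported_def space_lborel_Rn indicator_def)
qed (use assms in \<open>simp add: box_supported_def\<close>)

lemma lborel_Rn_Suc: "lborel_Rn (Suc n) = PiM (insert n {..<n}) (\<lambda>_. lborel)"
  by (simp add: lborel_Rn_def lessThan_Suc)

lemma upd_in_Rn: "x \<in> Rn n \<Longrightarrow> x(n := t) \<in> Rn (Suc n)"
  by (auto simp: Rn_def PiE_iff extensional_def)

lemma mix_upd: "mix (Suc n) l (x(n := s)) (y(n := t)) = (mix n l x y)(n := (1 - l) * s + l * t)"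
  by (auto simp: mix_def fun_eq_iff)

lemma box_supported_section:
  assumes f: "box_supported (Suc n) R K f" and x: "x \<in> Rn n"
  shows "(\<lambda>t. f (x(n := t))) \<in> borel_measurable borel"
    and "0 \<le> f (x(n := t))" "f (x(n := t)) \<le> K" "\<bar>t\<bar> > R \<Longrightarrow> f (x(n := t)) = 0"
    and "integrable lborel (\<lambda>t. f (x(n := t)))"
proof -
  have [measurable]: "f \<in> borel_measurable (PiM (insert n {..<n}) (\<lambda>_. lborel))"
    using f by (simp add: box_supported_def lborel_Rn_Suc)
  have [measurable]: "x \<in> space (PiM {..<n} (\<lambda>_. lborel :: real measure))"
    using x by (simp add: Rn_def space_PiM)
  have "(\<lambda>t. x(n := t)) \<in> measurable lborel (PiM (insert n {..<n}) (\<lambda>_. lborel))"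
    by (rule measurable_fun_upd[where J="{..<n}"]) auto
  then have "(\<lambda>t. f (x(n := t))) \<in> borel_measurable lborel"
    by (rule measurable_compose) measurable
  then show m: "(\<lambda>t. f (x(n := t))) \<in> borel_measurable borel" by simp
  have bd: "0 \<le> f (x(n := t))" "f (x(n := t)) \<le> K" for t
    using f upd_in_Rn[OF x] by (auto simp: box_supported_def)
  then show "0 \<le> f (x(n := t))" "f (x(n := t)) \<le> K" by auto
  have zero: "f (x(n := t)) = 0" if "\<bar>t\<bar> > R" for t
    using f upd_in_Rn[OF x, of t] that by (force simp: box_supported_def Box_def)
  then show "\<bar>t\<bar> > R \<Longrightarrow> f (x(n := t)) = 0" by auto
  show "integrable lborel (\<lambda>t. f (x(n := t)))"
    using m bd zero by (intro integrable_bounded_support[where K=K and R=R]) (simp_all add: abs_of_nonneg)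
qed

lemma box_supported_marginal:
  assumes f: "box_supported (Suc n) R K f" and R: "R \<ge> 0"
  shows "box_supported n R (K * (2 * R)) (\<lambda>x. \<integral>t. f (x(n := t)) \<partial>lborel)"
    and "(\<integral>x. f x \<partial>lborel_Rn (Suc n)) = (\<integral>x. (\<integral>t. f (x(n := t)) \<partial>lborel) \<partial>lborel_Rn n)"
proof -
  interpret product_sigma_finite "\<lambda>_::nat. lborel :: real measure"
    by (rule product_sigma_finite_lborel)
  have fm [measurable]: "f \<in> borel_measurable (PiM (insert n {..<n}) (\<lambda>_. lborel))"
    using f by (simp add: box_supported_def lborel_Rn_Suc)
  have "(\<lambda>(x, t). f (x(n := t))) \<in> borel_measurable (PiM {..<n} (\<lambda>_. lborel) \<Otimes>\<^sub>M lborel)"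
    using measurable_compose[OF measurable_add_dim fm] by (simp add: case_prod_beta')
  then have m: "(\<lambda>x. \<integral>t. f (x(n := t)) \<partial>lborel) \<in> borel_measurable (lborel_Rn n)"
    unfolding lborel_Rn_def by (intro lborel.borel_measurable_lebesgue_integral) auto
  have le: "(\<integral>t. f (x(n := t)) \<partial>lborel) \<le> K * (2 * R)" if x: "x \<in> Rn n" for x
  proof -
    have "(\<integral>t. f (x(n := t)) \<partial>lborel) \<le> (\<integral>t. K * indicator {-R..R} t \<partial>lborel)"
    proof (rule integral_mono)
      show "integrable lborel (\<lambda>t. f (x(n := t)))"
        by (rule box_supported_section(5)[OF f x])
      show "integrable lborel (\<lambda>t. K * indicator {-R..R} t)"
        by (intro integrable_mult_right integrable_real_indicator) (auto simp: emeasure_lborel_Icc_eq)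
      show "f (x(n := t)) \<le> K * indicator {-R..R} t" for t
        using box_supported_section(3,4)[OF f x, of t]
        by (auto simp: indicator_def abs_le_iff)
    qed
    also have "\<dots> = K * (2 * R)" using R by simp
    finally show ?thesis .
  qed
  have zero: "(\<integral>t. f (x(n := t)) \<partial>lborel) = 0" if x: "x \<in> Rn n - Box n R" for x
  proof -
    have "f (x(n := t)) = 0" for t
    proof -
      obtain i where i: "i < n" "\<bar>x i\<bar> > R" using x by (auto simp: Box_def not_le)
      then have "x(n := t) \<notin> Box (Suc n) R"
        unfolding Box_def by (auto simp: not_le intro!: exI[of _ i])
      then show ?thesis using f x upd_in_Rn[of x n t] by (auto simp: box_supported_def)
    qed
    then show ?thesis by simp
  qed
  show "box_supported n R (K * (2 * R)) (\<lambda>x. \<integral>t. f (x(n := t)) \<partial>lborel)"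
    using m le zero box_supported_section(2)[OF f]
    by (auto simp: box_supported_def intro!: integral_nonneg)
  show "(\<integral>x. f x \<partial>lborel_Rn (Suc n)) = (\<integral>x. (\<integral>t. f (x(n := t)) \<partial>lborel) \<partial>lborel_Rn n)"
    using box_supported_integrable[OF f] unfolding lborel_Rn_Suc
    by (subst product_integral_insert) (auto simp: lborel_Rn_def)
qed

text \<open>Induction on n: the one-dimensional inequality on the fibres over x, y and
  \<open>mix n l x y\<close> is the hypothesis for the marginals. K is generalised because the
  marginals have another bound.\<close>

theorem Prekopa_Leindler:
  assumes R: "R \<ge> 0" and l: "0 < l" "l < 1"
    and "box_supported n R K f" "box_supported n R K g" "box_supported n R K h"
    and "\<And>x y. x \<in> Rn n \<Longrightarrow> y \<in> Rn n \<Longrightarrow> f x powr (1 - l) * g y powr l \<le> h (mix n l x y)"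
  shows "(\<integral>x. f x \<partial>lborel_Rn n) powr (1 - l) * (\<integral>x. g x \<partial>lborel_Rn n) powr l \<le> (\<integral>x. h x \<partial>lborel_Rn n)"
  using assms(4-)
proof (induction n arbitrary: f g h K)
  case 0
  \<comment> \<open>\<open>Rn 0\<close> has a single point, and the integrals are the values
    there.\<close>
  have "f (\<lambda>_. undefined) powr (1 - l) * g (\<lambda>_. undefined) powr l \<le> h (mix 0 l (\<lambda>_. undefined) (\<lambda>_. undefined))"
    by (rule 0) (auto simp: Rn_def)
  then show ?case
    by (simp add: lborel_Rn_def PiM_empty lebesgue_integral_count_space_finite mix_def restrict_def)
next
  case (Suc n)
  note f = Suc.prems(1) and g = Suc.prems(2) and h = Suc.prems(3)
  show ?case
    unfolding box_supported_marginal(2)[OF f R] box_supported_marginal(2)[OF g R]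
      box_supported_marginal(2)[OF h R]
  proof (rule Suc.IH[OF box_supported_marginal(1)[OF f R] box_supported_marginal(1)[OF g R]
        box_supported_marginal(1)[OF h R]])
    fix x y assume x: "x \<in> Rn n" and y: "y \<in> Rn n"
    show "(\<integral>t. f (x(n := t)) \<partial>lborel) powr (1 - l) * (\<integral>t. g (y(n := t)) \<partial>lborel) powr l
        \<le> (\<integral>t. h ((mix n l x y)(n := t)) \<partial>lborel)"
    proof (rule Prekopa_Leindler_real[where K=K and R=R])
      show "integrable lborel (\<lambda>t. h ((mix n l x y)(n := t)))"
        by (rule box_supported_section(5)[OF h mix_in_Rn])
      show "f (x(n := s)) powr (1 - l) * g (y(n := t)) powr l
          \<le> h ((mix n l x y)(n := (1 - l) * s + l * t))" for s t
        using Suc.prems(4)[OF upd_in_Rn[OF x, of s] upd_in_Rn[OF y, of t]] unfolding mix_upd .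
    qed (use box_supported_section[OF f x] box_supported_section[OF g y]
          box_supported_section(2)[OF h mix_in_Rn] l in blast)+
  qed
qed

corollary Brunn_Minkowski:
  assumes [measurable]: "A \<in> sets (lborel_Rn n)" "B \<in> sets (lborel_Rn n)" "C \<in> sets (lborel_Rn n)"
    and sub: "A \<subseteq> Box n R" "B \<subseteq> Box n R" "C \<subseteq> Box n R" and R: "R \<ge> 0" and l: "0 < l" "l < 1"
    and AB: "\<And>x y. x \<in> A \<Longrightarrow> y \<in> B \<Longrightarrow> mix n l x y \<in> C"
  shows "measure (lborel_Rn n) A powr (1 - l) * measure (lborel_Rn n) B powr l \<le> measure (lborel_Rn n) C"
proof -
  have *: "(\<integral>x. indicator S x \<partial>lborel_Rn n) = measure (lborel_Rn n) S" "box_supported n R 1 (indicator S)"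
    if "S \<in> sets (lborel_Rn n)" "S \<subseteq> Box n R" for S
  proof -
    have "S \<inter> space (lborel_Rn n) = S" using that(1) sets.sets_into_space by blast
    then show "(\<integral>x. indicator S x \<partial>lborel_Rn n) = measure (lborel_Rn n) S" by simp
    have "(indicator S :: _ \<Rightarrow> real) \<in> borel_measurable (lborel_Rn n)" using that(1) by simp
    then show "box_supported n R 1 (indicator S)"
      using that(2) by (auto simp: box_supported_def indicator_def)
  qed
  have "(\<integral>x. indicator A x \<partial>lborel_Rn n) powr (1 - l) * (\<integral>x. indicator B x \<partial>lborel_Rn n) powr l
      \<le> (\<integral>x. indicator C x \<partial>lborel_Rn n)"
  proof (rule Prekopa_Leindler[OF R l, where K=1])
    show "indicator A x powr (1 - l) * indicator B y powr l \<le> (indicator C (mix n l x y) :: real)" for x y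
      \<comment> \<open>Since \<open>0 powr l = 0\<close>, the left side vanishes unless x is in A
        and y in B.\<close>
      using AB[of x y] by (cases "x \<in> A \<and> y \<in> B") (auto simp: indicator_def)
  qed (intro *(2) sub assms)+
  then show ?thesis using * sub by simp
qed

section \<open>Convex sets and the tails of affine functions on them\<close>

definition convex_Rn :: "nat \<Rightarrow> (nat \<Rightarrow> real) set \<Rightarrow> bool" where
  "convex_Rn n Q \<longleftrightarrow> (\<forall>x\<in>Q. \<forall>y\<in>Q. \<forall>l. 0 < l \<and> l < 1 \<longrightarrow> mix n l x y \<in> Q)"

text \<open>By Brunn-Minkowski the tail G is log-concave. The levels \<open>b + u\<close> and
  \<open>b + w\<close> are convex combinations of \<open>b\<close> and \<open>b + u + w\<close> with
  complementary weights, so multiplying the two resulting inequalities removes the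
  exponents.\<close>

lemma tail_submultiplicative:
  fixes t :: "(nat \<Rightarrow> real) \<Rightarrow> real"
  assumes Q [measurable]: "Q \<in> sets (lborel_Rn n)" and bdd: "Q \<subseteq> Box n R" and cvx: "convex_Rn n Q"
    and t [measurable]: "t \<in> borel_measurable (lborel_Rn n)"
    and aff: "\<And>l x y. t (mix n l x y) = (1 - l) * t x + l * t y"
    and uw: "u \<ge> 0" "w \<ge> 0"
  defines "G \<equiv> \<lambda>b. measure (lborel_Rn n) {x\<in>Q. b < t x}"
  shows "G (b + u + w) * G b \<le> G (b + u) * G (b + w)"
proof (cases "u = 0 \<or> w = 0")
  case True
  then show ?thesis by (auto simp: mult.commute)
next
  case False
  then have uw: "u > 0" "w > 0" using uw by auto
  have sets: "{x\<in>Q. c < t x} \<in> sets (lborel_Rn n)" for c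
  proof -
    have "{x\<in>space (lborel_Rn n). x \<in> Q \<and> c < t x} \<in> sets (lborel_Rn n)" by measurable
    moreover have "{x\<in>space (lborel_Rn n). x \<in> Q \<and> c < t x} = {x\<in>Q. c < t x}"
      using sets.sets_into_space[OF Q] by auto
    ultimately show ?thesis by simp
  qed
  have bdd': "Q \<subseteq> Box n (max R 0)" using bdd by (force simp: Box_def)
  have *: "G b powr (1 - u / (u + w)) * G (b + u + w) powr (u / (u + w)) \<le> G (b + u)" if "u > 0" "w > 0" for u w
    unfolding G_def
  proof (rule Brunn_Minkowski[OF sets sets sets, where R="max R 0"])
    fix x y assume x: "x \<in> {x\<in>Q. b < t x}" and y: "y \<in> {x\<in>Q. b + u + w < t x}"
    let ?l = "u / (u + w)"
    have l: "0 < ?l" "?l < 1" using that by auto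
    then have "mix n ?l x y \<in> Q" using cvx x y by (auto simp: convex_Rn_def)
    moreover have "(1 - ?l) * b + ?l * (b + u + w) < (1 - ?l) * t x + ?l * t y"
      using x y l by (intro add_strict_mono mult_strict_left_mono) auto
    moreover have "(1 - ?l) * b + ?l * (b + u + w) = b + u"
    proof -
      have "(1 - ?l) * b + ?l * (b + u + w) = b + ?l * (u + w)" by (simp only: algebra_simps)
      then show ?thesis using that by simp
    qed
    ultimately show "mix n ?l x y \<in> {x\<in>Q. b + u < t x}" by (simp add: aff)
  qed (use bdd' that in auto)
  have eq: "1 - w / (w + u) = u / (u + w)" "1 - u / (u + w) = w / (u + w)"
    using uw add_divide_distrib[of u w "u + w"] by (auto simp: add.commute[of w u])
  have nn: "0 \<le> G c" for c by (simp add: G_def)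
  have split: "G c powr (w / (u + w)) * G c powr (u / (u + w)) = G c" for c
  proof -
    have "w / (u + w) + u / (u + w) = 1" using eq by simp
    then show ?thesis using nn[of c] by (simp flip: powr_add)
  qed
  have 1: "G b powr (w / (u + w)) * G (b + u + w) powr (u / (u + w)) \<le> G (b + u)"
    using *[OF uw] by (simp add: eq)
  have 2: "G b powr (u / (u + w)) * G (b + u + w) powr (w / (u + w)) \<le> G (b + w)"
    using *[OF uw(2,1)] unfolding eq(1) by (simp add: add_ac)
  have "G (b + u + w) * G b = (G b powr (w / (u + w)) * G (b + u + w) powr (u / (u + w))) *
      (G b powr (u / (u + w)) * G (b + u + w) powr (w / (u + w)))"
    by (subst split[of b, symmetric], subst split[of "b + u + w", symmetric]) (simp only: mult_ac)
  also have "\<dots> \<le> G (b + u) * G (b + w)"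
    using 1 2 nn by (intro mult_mono) auto
  finally show ?thesis .
qed

section \<open>Random variables with log-concave tails\<close>

text \<open>Log-concavity of the tail in a four-point form without logarithms or quotients, which
  makes sense also where the tail vanishes.\<close>

definition log_concave_tail :: "'a measure \<Rightarrow> ('a \<Rightarrow> real) \<Rightarrow> bool" where
  "log_concave_tail M t \<longleftrightarrow> (\<forall>b u w. 0 \<le> u \<longrightarrow> 0 \<le> w \<longrightarrow>
     measure M {x\<in>space M. b + u + w < t x} * measure M {x\<in>space M. b < t x}
     \<le> measure M {x\<in>space M. b + u < t x} * measure M {x\<in>space M. b + w < t x})"

lemma log_concave_tail_scale:
  assumes "log_concave_tail M t" "c > 0"
  shows "log_concave_tail M (\<lambda>x. t x / c)"
  unfolding log_concave_tail_def
proof (intro allI impI)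
  fix b u w :: real assume "0 \<le> u" "0 \<le> w"
  moreover have "(s < t x / c) = (s * c < t x)" for s x
    using assms(2) by (simp add: pos_less_divide_eq)
  ultimately show "measure M {x\<in>space M. b + u + w < t x / c} * measure M {x\<in>space M. b < t x / c}
     \<le> measure M {x\<in>space M. b + u < t x / c} * measure M {x\<in>space M. b + w < t x / c}"
    using assms(1)[unfolded log_concave_tail_def, rule_format, of "u * c" "w * c" "b * c"] assms(2)
    by (simp add: distrib_right)
qed

text \<open>Writes half the squared excess over a threshold as an integral of excesses over all
  higher thresholds, so that second moments are reached by integrating the tail twice.\<close>

lemma nn_integral_ramp:
  "(\<integral>\<^sup>+u. ennreal (a - u) * indicator {0..} u \<partial>lborel) = ennreal ((max 0 a)\<^sup>2 / 2)"
proof (cases "a \<ge> 0")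
  case True
  have "(\<integral>\<^sup>+u. ennreal (a - u) * indicator {0..} u \<partial>lborel)
      = (\<integral>\<^sup>+u. ennreal (a - u) * indicator {0..a} u \<partial>lborel)"
    by (intro nn_integral_cong) (auto simp: indicator_def ennreal_neg)
  also have "\<dots> = ennreal ((a * a - a\<^sup>2 / 2) - (a * 0 - 0\<^sup>2 / 2))"
  proof (rule nn_integral_FTC_Icc)
    show "((\<lambda>u. a * u - u\<^sup>2 / 2) has_real_derivative a - u) (at u)" for u
      by (auto intro!: derivative_eq_intros)
  qed (use True in auto)
  finally show ?thesis using True by (simp add: power2_eq_square)
next
  case False
  have "(\<integral>\<^sup>+u. ennreal (a - u) * indicator {0..} u \<partial>lborel) = (\<integral>\<^sup>+u. 0 \<partial>(lborel :: real measure))"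
    using False by (intro nn_integral_cong) (auto simp: indicator_def ennreal_neg)
  then show ?thesis using False by simp
qed

context prob_space
begin

lemma tail_integral:
  assumes [measurable]: "t \<in> borel_measurable M"
  shows "(\<integral>\<^sup>+x. ennreal (t x - b) \<partial>M) =
    (\<integral>\<^sup>+u. emeasure M {x\<in>space M. b + u < t x} * indicator {0..} u \<partial>lborel)"
proof -
  have "{x\<in>space M. u < t x - b} = {x\<in>space M. b + u < t x}" for u by auto
  then show ?thesis
    using nn_integral_layer_cake[OF sigma_finite_measure_axioms, of "\<lambda>x. t x - b"] by simp
qed

lemma log_concave_tail_emeasure:
  assumes "log_concave_tail M t" "0 \<le> u" "0 \<le> w"
  shows "emeasure M {x\<in>space M. b + u + w < t x} * emeasure M {x\<in>space M. b < t x}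
     \<le> emeasure M {x\<in>space M. b + u < t x} * emeasure M {x\<in>space M. b + w < t x}"
  using assms unfolding log_concave_tail_def emeasure_eq_measure
  by (simp add: ennreal_mult[symmetric])

text \<open>The four-point inequality integrated over w: the mean excess over a threshold, given
  that it is exceeded, does not grow with the threshold.\<close>

lemma log_concave_tail_excess_nn:
  assumes lc: "log_concave_tail M t" and [measurable]: "t \<in> borel_measurable M" and u: "0 \<le> u"
  shows "(\<integral>\<^sup>+x. ennreal (t x - (b + u)) \<partial>M) * emeasure M {x\<in>space M. b < t x}
     \<le> emeasure M {x\<in>space M. b + u < t x} * (\<integral>\<^sup>+x. ennreal (t x - b) \<partial>M)"
proof -
  let ?G = "\<lambda>b. emeasure M {x\<in>space M. b < t x}"
  have [measurable]: "(\<lambda>w. ?G (c + w)) \<in> borel_measurable borel" for c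
    by measurable
  have "(\<integral>\<^sup>+x. ennreal (t x - (b + u)) \<partial>M) * ?G b
      = (\<integral>\<^sup>+w. ?G (b + u + w) * indicator {0..} w * ?G b \<partial>lborel)"
    unfolding tail_integral[OF assms(2)] by (subst nn_integral_multc) auto
  also have "\<dots> \<le> (\<integral>\<^sup>+w. ?G (b + u) * (?G (b + w) * indicator {0..} w) \<partial>lborel)"
    using log_concave_tail_emeasure[OF lc u]
    by (intro nn_integral_mono) (auto simp: indicator_def)
  also have "\<dots> = ?G (b + u) * (\<integral>\<^sup>+x. ennreal (t x - b) \<partial>M)"
    unfolding tail_integral[OF assms(2)] by (subst nn_integral_cmult) auto
  finally show ?thesis .
qed

text \<open>The previous inequality integrated once more, over u. The exponential law, whose
  conditional mean excess is constant, gives equality.\<close>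

lemma log_concave_tail_second_moment_nn:
  assumes lc: "log_concave_tail M t" and [measurable]: "t \<in> borel_measurable M"
  shows "(\<integral>\<^sup>+x. ennreal ((max 0 (t x - b))\<^sup>2 / 2) \<partial>M) * emeasure M {x\<in>space M. b < t x}
     \<le> (\<integral>\<^sup>+x. ennreal (t x - b) \<partial>M)\<^sup>2"
proof -
  interpret pair_sigma_finite M lborel ..
  let ?G = "\<lambda>b. emeasure M {x\<in>space M. b < t x}"
  let ?E = "\<lambda>b. \<integral>\<^sup>+x. ennreal (t x - b) \<partial>M"
  have [measurable]: "(\<lambda>w. ?G (c + w)) \<in> borel_measurable borel" for c
    by measurable
  have [measurable]: "(\<lambda>w. ?E (b + w)) \<in> borel_measurable borel"
    by measurable
  have "(\<integral>\<^sup>+x. ennreal ((max 0 (t x - b))\<^sup>2 / 2) \<partial>M)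
      = (\<integral>\<^sup>+x. (\<integral>\<^sup>+u. ennreal (t x - (b + u)) * indicator {0..} u \<partial>lborel) \<partial>M)"
    by (simp add: nn_integral_ramp[symmetric] diff_diff_eq)
  also have "\<dots> = (\<integral>\<^sup>+u. (\<integral>\<^sup>+x. ennreal (t x - (b + u)) * indicator {0..} u \<partial>M) \<partial>lborel)"
    by (intro Fubini'[symmetric]) simp
  also have "\<dots> = (\<integral>\<^sup>+u. ?E (b + u) * indicator {0..} u \<partial>lborel)"
    by (intro nn_integral_cong nn_integral_multc) simp
  finally have "(\<integral>\<^sup>+x. ennreal ((max 0 (t x - b))\<^sup>2 / 2) \<partial>M) * ?G b
      = (\<integral>\<^sup>+u. ?E (b + u) * indicator {0..} u * ?G b \<partial>lborel)"
    by (simp add: nn_integral_multc)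
  also have "\<dots> \<le> (\<integral>\<^sup>+u. (?G (b + u) * indicator {0..} u) * ?E b \<partial>lborel)"
    using log_concave_tail_excess_nn[OF lc]
    by (intro nn_integral_mono) (auto simp: indicator_def)
  also have "\<dots> = ?E b * ?E b"
    unfolding tail_integral[OF assms(2), symmetric] by (simp add: nn_integral_multc tail_integral)
  finally show ?thesis by (simp add: power2_eq_square)
qed

lemma bounded_integrable:
  fixes f :: "'a \<Rightarrow> real"
  assumes "f \<in> borel_measurable M" "\<And>x. x \<in> space M \<Longrightarrow> \<bar>f x\<bar> \<le> C"
  shows "integrable M f"
  using assms by (intro integrable_const_bound[where B=C]) auto

context
  fixes t :: "'a \<Rightarrow> real" and K :: real
  assumes t [measurable]: "t \<in> borel_measurable M"
    and tK: "\<And>x. x \<in> space M \<Longrightarrow> \<bar>t x\<bar> \<le> K"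
begin

lemma integrable_t: "integrable M t"
  using tK by (intro bounded_integrable[where C=K]) auto

lemma integrable_excess: "integrable M (\<lambda>x. max 0 (t x - b))"
  using tK by (intro bounded_integrable[where C="K + \<bar>b\<bar>"]) (auto simp: abs_le_iff, force+)

lemma integrable_excess_square: "integrable M (\<lambda>x. (max 0 (t x - b))\<^sup>2)"
proof (rule bounded_integrable)
  fix x assume "x \<in> space M"
  then have "\<bar>max 0 (t x - b)\<bar> \<le> K + \<bar>b\<bar>" using tK[of x] by (auto simp: abs_le_iff)
  then show "\<bar>(max 0 (t x - b))\<^sup>2\<bar> \<le> (K + \<bar>b\<bar>)\<^sup>2"
    by (metis abs_power2 abs_ge_zero power2_abs power_mono)
qed simp

lemma nn_integral_excess: "(\<integral>\<^sup>+x. ennreal (t x - b) \<partial>M) = ennreal (expectation (\<lambda>x. max 0 (t x - b)))"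
proof -
  have "(\<integral>\<^sup>+x. ennreal (t x - b) \<partial>M) = (\<integral>\<^sup>+x. ennreal (max 0 (t x - b)) \<partial>M)"
    by (intro nn_integral_cong) (auto simp: max_def ennreal_neg)
  then show ?thesis
    using integrable_excess by (simp add: nn_integral_eq_integral)
qed

lemma log_concave_tail_excess:
  assumes "log_concave_tail M t" "0 \<le> u"
  shows "expectation (\<lambda>x. max 0 (t x - (b + u))) * prob {x\<in>space M. b < t x}
     \<le> prob {x\<in>space M. b + u < t x} * expectation (\<lambda>x. max 0 (t x - b))"
  using log_concave_tail_excess_nn[OF assms(1) t assms(2), of b]
  unfolding nn_integral_excess emeasure_eq_measure
  by (simp add: ennreal_mult[symmetric] integral_nonneg)

lemma log_concave_tail_second_moment:
  assumes "log_concave_tail M t"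
  shows "expectation (\<lambda>x. (max 0 (t x - b))\<^sup>2) * prob {x\<in>space M. b < t x}
     \<le> 2 * (expectation (\<lambda>x. max 0 (t x - b)))\<^sup>2"
proof -
  have "(\<integral>\<^sup>+x. ennreal ((max 0 (t x - b))\<^sup>2 / 2) \<partial>M) = ennreal (expectation (\<lambda>x. (max 0 (t x - b))\<^sup>2) / 2)"
    using integrable_excess_square[of b] by (simp add: nn_integral_eq_integral)
  then have "ennreal (expectation (\<lambda>x. (max 0 (t x - b))\<^sup>2) / 2 * prob {x\<in>space M. b < t x})
     \<le> ennreal ((expectation (\<lambda>x. max 0 (t x - b)))\<^sup>2)"
    using log_concave_tail_second_moment_nn[OF assms t, of b]
    unfolding nn_integral_excess emeasure_eq_measure
    by (subst ennreal_mult) (auto simp: ennreal_power integral_nonneg)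
  then have "expectation (\<lambda>x. (max 0 (t x - b))\<^sup>2) / 2 * prob {x\<in>space M. b < t x}
     \<le> (expectation (\<lambda>x. max 0 (t x - b)))\<^sup>2"
    by (subst (asm) ennreal_le_iff) auto
  then show ?thesis by linarith
qed

text \<open>Gruenbaum's inequality has \<open>1 / e\<close> here; for \<open>1 / 6\<close> it is enough to apply Markov's
  inequality at \<open>-2 m\<close>, where \<open>m\<close> is the mean of \<open>max 0 t\<close>.\<close>

lemma prob_pos_ge:
  assumes lc: "log_concave_tail M t" and mean: "expectation t = 0"
    and nz: "\<not> (AE x in M. t x = 0)"
  shows "1 / 6 \<le> prob {x\<in>space M. 0 < t x}"
proof -
  define m where "m = expectation (\<lambda>x. max 0 (t x - 0))"
  define q where "q = prob {x\<in>space M. 0 < t x}"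
  have int_neg: "integrable M (\<lambda>x. max 0 (- t x))"
  proof (rule bounded_integrable)
    fix x assume "x \<in> space M"
    then show "\<bar>max 0 (- t x)\<bar> \<le> K" using tK[of x] by linarith
  qed simp
  have "expectation (\<lambda>x. max 0 (- t x)) = expectation (\<lambda>x. max 0 (t x - 0) - t x)"
    by (intro Bochner_Integration.integral_cong) auto
  also have "\<dots> = m"
    using integrable_excess[of 0] integrable_t mean unfolding m_def
    by (subst Bochner_Integration.integral_diff) auto
  finally have neg: "expectation (\<lambda>x. max 0 (- t x)) = m" .
  have "expectation (\<lambda>x. \<bar>t x\<bar>) = expectation (\<lambda>x. max 0 (t x - 0) + max 0 (- t x))"
    by (intro Bochner_Integration.integral_cong) auto
  also have "\<dots> = 2 * m"
    using integrable_excess[of 0] int_neg neg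
    by (subst Bochner_Integration.integral_add) (auto simp: m_def)
  finally have abs: "expectation (\<lambda>x. \<bar>t x\<bar>) = 2 * m" .
  have m: "m > 0"
  proof (rule ccontr)
    assume "\<not> m > 0"
    moreover have "0 \<le> expectation (\<lambda>x. \<bar>t x\<bar>)" by simp
    ultimately have "expectation (\<lambda>x. \<bar>t x\<bar>) = 0" using abs by linarith
    then have "AE x in M. \<bar>t x\<bar> = 0"
      using integrable_t by (subst (asm) integral_nonneg_eq_0_iff_AE) auto
    then show False using nz by simp
  qed
  have "m * prob {x\<in>space M. - (2 * m) < t x} \<le> q * expectation (\<lambda>x. max 0 (t x - - (2 * m)))"
    using log_concave_tail_excess[OF lc, of "2 * m" "- (2 * m)"] m by (simp add: m_def q_def)
  \<comment> \<open>The mean excess over \<open>-2 m\<close> is at most \<open>3 m\<close>, three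
    times that over 0. Hence \<open>t > -2 m\<close> has probability at most \<open>3 q\<close>,
    while Markov gives it at least 1/2.\<close>
  also have "\<dots> \<le> q * expectation (\<lambda>x. max 0 (t x - 0) + 2 * m)"
    using integrable_excess[of 0] integrable_excess[of "- (2 * m)"] m
    by (intro mult_left_mono integral_mono) (auto simp: q_def)
  also have "\<dots> = m * (3 * q)"
    using integrable_excess[of 0] by (simp add: m_def[symmetric] prob_space) (simp add: m_def)
  finally have "m * prob {x\<in>space M. - (2 * m) < t x} \<le> m * (3 * q)" .
  then have 1: "prob {x\<in>space M. - (2 * m) < t x} \<le> 3 * q" using m by simp
  have "prob {x\<in>space M. 2 * m \<le> max 0 (- t x)} \<le> expectation (\<lambda>x. max 0 (- t x)) / (2 * m)"
    using int_neg m by (intro integral_Markov_inequality_measure[where A="{}"]) auto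
  then have 2: "prob {x\<in>space M. 2 * m \<le> max 0 (- t x)} \<le> 1 / 2" using neg m by simp
  have "{x\<in>space M. 2 * m \<le> max 0 (- t x)} = space M - {x\<in>space M. - (2 * m) < t x}"
    using m by (auto simp: max_def)
  then have "prob {x\<in>space M. 2 * m \<le> max 0 (- t x)} = 1 - prob {x\<in>space M. - (2 * m) < t x}"
    by (simp add: prob_compl)
  with 1 2 show ?thesis by (simp add: q_def)
qed

end

text \<open>Extremal is the shifted exponential law, for which \<open>1 - t\<close> is exponential and nothing
  exceeds 1.\<close>

lemma second_moment_le_unit:
  assumes t [measurable]: "t \<in> borel_measurable M" and tK: "\<And>x. x \<in> space M \<Longrightarrow> \<bar>t x\<bar> \<le> K"
    and lc: "log_concave_tail M t" "log_concave_tail M (\<lambda>x. - t x)"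
    and mean: "expectation t = 0"
  defines "p \<equiv> prob {x\<in>space M. 1 < t x}"
  assumes p: "p \<le> 1 / 12"
  shows "expectation (\<lambda>x. (t x)\<^sup>2) \<le> 1 + 20 * p"
proof (cases "AE x in M. t x = 0")
  case True
  then have "expectation (\<lambda>x. (t x)\<^sup>2) = 0"
    by (intro integral_eq_zero_AE) auto
  moreover have "0 \<le> p" by (simp add: p_def)
  ultimately show ?thesis by linarith
next
  case False
  have p0: "0 \<le> p" by (simp add: p_def)
  note int = integrable_excess[OF t tK] and int2 = integrable_excess_square[OF t tK]
  have tK': "\<bar>- t x\<bar> \<le> K" if "x \<in> space M" for x using tK[OF that] by simp
  have t' [measurable]: "(\<lambda>x. - t x) \<in> borel_measurable M" by simp
  note int' = integrable_excess[OF t' tK'] and int2' = integrable_excess_square[OF t' tK']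
  define q where "q = prob {x\<in>space M. 0 < t x}"
  define a where "a = expectation (\<lambda>x. max 0 (t x - 1))"
  have q: "1 / 6 \<le> q" unfolding q_def by (rule prob_pos_ge[OF t tK lc(1) mean False])
  have a0: "0 \<le> a" by (simp add: a_def integral_nonneg)
  have "a * q \<le> p * expectation (\<lambda>x. max 0 (t x - 0))"
    using log_concave_tail_excess[OF t tK lc(1), of 1 0] by (simp add: a_def q_def p_def)
  also have "expectation (\<lambda>x. max 0 (t x - 0)) \<le>
      expectation (\<lambda>x. max 0 (t x - 1) + indicator {x\<in>space M. 0 < t x} x)"
    using int[of 0] int[of 1]
    by (intro integral_mono Bochner_Integration.integrable_add integrable_real_indicator)
       (auto simp: indicator_def emeasure_eq_measure)
  also have "\<dots> = a + q"
    using int[of 1] by (subst Bochner_Integration.integral_add) (auto simp: a_def q_def emeasure_eq_measure)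
  finally have "a * q \<le> p * (a + q)" using p0 by (simp add: mult_left_mono)
  then have "a * (q - p) \<le> p * q" by (simp add: algebra_simps)
  \<comment> \<open>The assumed bound 1/12 on p is half the lower bound 1/6 on q.\<close>
  moreover have "a * (q / 2) \<le> a * (q - p)"
    using a0 p q by (intro mult_left_mono) auto
  ultimately have "a * (q / 2) \<le> p * q" by linarith
  then have a: "a \<le> 2 * p" using q by (simp add: field_simps)
  define b2 where "b2 = expectation (\<lambda>x. (max 0 (t x - 1))\<^sup>2)"
  define b3 where "b3 = expectation (\<lambda>x. (max 0 (1 - t x))\<^sup>2)"
  have b2: "b2 \<le> 8 * p"
  \<comment> \<open>The moment inequality bounds \<open>b2 * p\<close> by \<open>8 * p * p\<close>;
    the factor p can be cancelled only if it is nonzero.\<close>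
  proof (cases "p = 0")
    case True
    then have "AE x in M. \<not> 1 < t x"
      unfolding p_def by (subst (asm) prob_eq_0) auto
    then have "AE x in M. (max 0 (t x - 1))\<^sup>2 = 0" by eventually_elim auto
    then have "b2 = 0" unfolding b2_def by (intro integral_eq_zero_AE) auto
    then show ?thesis using p0 by simp
  next
    case False
    have "b2 * p \<le> 2 * a\<^sup>2"
      using log_concave_tail_second_moment[OF t tK lc(1), of 1] by (simp add: b2_def p_def a_def)
    also have "\<dots> \<le> 2 * (2 * p)\<^sup>2" using a a0 by (intro mult_left_mono power_mono) auto
    also have "\<dots> = (8 * p) * p" by (simp add: power2_eq_square)
    finally show ?thesis using False p0 by simp
  qed
  have neg1: "expectation (\<lambda>x. max 0 (1 - t x)) = 1 + a"
  proof -
    have "expectation (\<lambda>x. max 0 (1 - t x)) = expectation (\<lambda>x. (1 - t x) + max 0 (t x - 1))"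
      by (intro Bochner_Integration.integral_cong) auto
    also have "\<dots> = 1 + a"
      using int[of 1] integrable_t[OF t tK] mean by (simp add: a_def prob_space)
    finally show ?thesis .
  qed
  \<comment> \<open>The tail of \<open>- t\<close> at level -1 is the event \<open>t < 1\<close>,
    whereas \<open>1 - p\<close> is the probability of \<open>t \<le> 1\<close>. Lowering the level
    by e allows for an atom at 1.\<close>
  have b3e: "sqrt (b3 * (1 - p) / 2) \<le> (1 + a) + e" if e: "e > 0" for e
  proof -
    have "b3 \<le> expectation (\<lambda>x. (max 0 (- t x - - (1 + e)))\<^sup>2)"
      unfolding b3_def using int2'[of "-1"] int2'[of "-(1 + e)"] e
      by (intro integral_mono) (auto intro!: power_mono)
    moreover have "1 - p \<le> prob {x\<in>space M. - (1 + e) < - t x}"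
    proof -
      have "1 - p = prob (space M - {x\<in>space M. 1 < t x})"
        unfolding p_def by (simp add: prob_compl)
      also have "\<dots> \<le> prob {x\<in>space M. - (1 + e) < - t x}"
        using e by (intro finite_measure_mono) auto
      finally show ?thesis .
    qed
    ultimately have "b3 * (1 - p) \<le> expectation (\<lambda>x. (max 0 (- t x - - (1 + e)))\<^sup>2) *
        prob {x\<in>space M. - (1 + e) < - t x}"
      using p by (intro mult_mono) (auto simp: integral_nonneg)
    also have "\<dots> \<le> 2 * (expectation (\<lambda>x. max 0 (- t x - - (1 + e))))\<^sup>2"
      by (rule log_concave_tail_second_moment[OF t' tK' lc(2)])
    also have "\<dots> \<le> 2 * ((1 + a) + e)\<^sup>2"
    proof -
      have "expectation (\<lambda>x. max 0 (- t x - - (1 + e))) \<le> expectation (\<lambda>x. max 0 (1 - t x) + e)"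
        using int'[of "-1"] int'[of "-(1 + e)"] e by (intro integral_mono) auto
      also have "\<dots> = (1 + a) + e"
        using int'[of "-1"] neg1 by (simp add: prob_space)
      finally show ?thesis by (intro mult_left_mono power_mono) (auto simp: integral_nonneg)
    qed
    finally show ?thesis using a0 e by (intro real_le_lsqrt) auto
  qed
  then have "sqrt (b3 * (1 - p) / 2) \<le> 1 + a" by (rule field_le_epsilon)
  then have "b3 * (1 - p) / 2 \<le> (1 + a)\<^sup>2"
    by (rule sqrt_le_D)
  also have "\<dots> \<le> (1 + 2 * p)\<^sup>2" using a a0 by (simp add: power_mono)
  finally have "b3 * (1 - p) \<le> 2 * (1 + 2 * p)\<^sup>2" by simp
  also have "\<dots> \<le> (2 + 12 * p) * (1 - p)"
  proof -
    have "p * p \<le> p * (1 / 12)" "0 \<le> p * p" using p p0 by (intro mult_left_mono mult_nonneg_nonneg; simp)+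
    moreover have "(2 + 12 * p) * (1 - p) - 2 * (1 + 2 * p)\<^sup>2 = 2 * p - 20 * (p * p)"
      by (simp add: power2_eq_square algebra_simps)
    ultimately show ?thesis by linarith
  qed
  finally have b3: "b3 \<le> 2 + 12 * p" using p by simp
  \<comment> \<open>The identity is \<open>t * t = (1 - t) * (1 - t) - 1 + 2 * t\<close>, with the
    square split at \<open>t = 1\<close> and the linear term of mean 0.\<close>
  have "expectation (\<lambda>x. (t x)\<^sup>2) = expectation (\<lambda>x. (max 0 (1 - t x))\<^sup>2 + (max 0 (t x - 1))\<^sup>2 - 1 + 2 * t x)"
    by (intro Bochner_Integration.integral_cong) (auto simp: max_def power2_eq_square algebra_simps)
  also have "\<dots> = b3 + b2 - 1"
    using int2[of 1] int2'[of "-1"] integrable_t[OF t tK] mean by (simp add: b2_def b3_def prob_space)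
  also have "\<dots> \<le> 1 + 20 * p" using b2 b3 by linarith
  finally show ?thesis .
qed

lemma second_moment_le:
  assumes t [measurable]: "t \<in> borel_measurable M" and tK: "\<And>x. x \<in> space M \<Longrightarrow> \<bar>t x\<bar> \<le> K"
    and lc: "log_concave_tail M t" "log_concave_tail M (\<lambda>x. - t x)"
    and mean: "expectation t = 0" and c: "c > 0"
    and p: "prob {x\<in>space M. c < t x} \<le> p" "p \<le> 1 / 12"
  shows "expectation (\<lambda>x. (t x)\<^sup>2) \<le> (1 + 20 * p) * c\<^sup>2"
proof -
  have eq: "{x\<in>space M. 1 < t x / c} = {x\<in>space M. c < t x}"
    using c by (auto simp: pos_less_divide_eq)
  have "expectation (\<lambda>x. (t x / c)\<^sup>2) \<le> 1 + 20 * prob {x\<in>space M. 1 < t x / c}"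
  proof (rule second_moment_le_unit)
    show "\<bar>t x / c\<bar> \<le> K / c" if "x \<in> space M" for x
      using tK[OF that] c by (simp add: divide_right_mono)
    show "log_concave_tail M (\<lambda>x. - (t x / c))"
      using log_concave_tail_scale[OF lc(2) c] by simp
  qed (use log_concave_tail_scale[OF lc(1) c] mean p in \<open>auto simp: eq\<close>)
  also have "\<dots> \<le> 1 + 20 * p" using p by (simp add: eq)
  finally have "expectation (\<lambda>x. (t x)\<^sup>2) / c\<^sup>2 \<le> 1 + 20 * p"
    by (simp add: power_divide)
  then show ?thesis using c by (simp add: pos_divide_le_eq)
qed

end

section \<open>Polyhedra and uniform distributions\<close>

definition polyh :: "nat \<Rightarrow> (nat \<Rightarrow> real) set \<Rightarrow> (nat \<Rightarrow> real) set" where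
  "polyh n F = {x \<in> Rn n. \<forall>v\<in>F. inner_Rn n x v \<le> 1}"

definition origin :: "nat \<Rightarrow> nat \<Rightarrow> real" where
  "origin n = (\<lambda>i\<in>{..<n}. 0)"

lemma origin_in_Rn [simp]: "origin n \<in> Rn n"
  by (simp add: origin_def Rn_def)

lemma inner_Rn_origin [simp]: "inner_Rn n (origin n) v = 0"
  by (simp add: inner_Rn_def origin_def)

lemma origin_in_polyh [simp]: "origin n \<in> polyh n F"
  by (simp add: polyh_def)

lemma polyh_subset_Rn: "polyh n F \<subseteq> Rn n"
  by (auto simp: polyh_def)

lemma polyh_antimono: "F \<subseteq> F' \<Longrightarrow> polyh n F' \<subseteq> polyh n F"
  by (auto simp: polyh_def)

lemma convex_polyh: "convex_Rn n (polyh n F)"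
  unfolding convex_Rn_def polyh_def
proof safe
  fix x y v and l :: real
  assume "\<forall>v\<in>F. inner_Rn n x v \<le> 1" "\<forall>v\<in>F. inner_Rn n y v \<le> 1" "0 < l" "l < 1" "v \<in> F"
  then have "(1 - l) * inner_Rn n x v + l * inner_Rn n y v \<le> (1 - l) * 1 + l * 1"
    by (intro add_mono mult_left_mono) auto
  then show "inner_Rn n (mix n l x y) v \<le> 1" by (simp add: inner_Rn_mix)
qed simp

lemma sets_polyh_countable:
  assumes "countable F" shows "polyh n F \<in> sets (lborel_Rn n)"
proof -
  have "polyh n F = space (lborel_Rn n) - (\<Union>v\<in>F. space (lborel_Rn n) - halfspace n v)"
    by (auto simp: polyh_def halfspace_def space_lborel_Rn)
  also have "\<dots> \<in> sets (lborel_Rn n)"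
    using assms by (intro sets.compl_sets sets.countable_UN'') (auto intro: halfspace_measurable)
  finally show ?thesis .
qed

text \<open>Lindelof for the open complements of the half-spaces. It makes arbitrary intersections
  measurable and lets a family be exhausted by a sequence.\<close>

lemma polyh_countable_subfamily:
  obtains W where "W \<subseteq> V" "countable W" "polyh n W = polyh n V"
proof -
  define U where "U v = {x. inner_Rn n x v > 1}" for v
  have "open (U v)" for v
    unfolding U_def inner_Rn_def
    by (intro open_Collect_less continuous_intros continuous_on_product_coordinates)
  then have "\<And>S. S \<in> U ` V \<Longrightarrow> open S" by auto
  from Lindelof[OF this]
  obtain \<F> where F: "\<F> \<subseteq> U ` V" "countable \<F>" "\<Union>\<F> = \<Union>(U ` V)"
    by metis
  obtain W where W: "W \<subseteq> V" "countable W" "\<F> = U ` W"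
    using F(1,2) countable_subset_image[of \<F> U V] by metis
  have "polyh n A = Rn n - \<Union>(U ` A)" for A
    by (auto simp: polyh_def U_def not_less)
  with F(3) W show thesis by (intro that[of W]) auto
qed

lemma sets_polyh [measurable]: "polyh n F \<in> sets (lborel_Rn n)"
proof -
  obtain W where "countable W" "polyh n W = polyh n F"
    by (rule polyh_countable_subfamily)
  then show ?thesis using sets_polyh_countable[of W n] by simp
qed

section \<open>Boundedness of convex sets of finite volume\<close>

lemma Box_subset_Rn: "Box n R \<subseteq> Rn n"
  by (auto simp: Box_def)

lemma Box_mono: "R \<le> S \<Longrightarrow> Box n R \<subseteq> Box n S"
  by (force simp: Box_def)

lemma convex_Box: "convex_Rn n (Box n R)"
  unfolding convex_Rn_def Box_def
proof safe
  fix x y i and l :: real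
  assume "\<forall>i<n. \<bar>x i\<bar> \<le> R" "\<forall>i<n. \<bar>y i\<bar> \<le> R" "0 < l" "l < 1" "i < n"
  then have "(1 - l) * \<bar>x i\<bar> + l * \<bar>y i\<bar> \<le> (1 - l) * R + l * R"
    by (intro add_mono mult_left_mono) auto
  moreover have "\<bar>(1 - l) * x i + l * y i\<bar> \<le> (1 - l) * \<bar>x i\<bar> + l * \<bar>y i\<bar>"
    using \<open>0 < l\<close> \<open>l < 1\<close> abs_triangle_ineq[of "(1 - l) * x i" "l * y i"] by (simp add: abs_mult)
  ultimately show "\<bar>mix n l x y i\<bar> \<le> R" using \<open>i < n\<close> by (simp add: algebra_simps)
qed simp

lemma convex_Int: "convex_Rn n A \<Longrightarrow> convex_Rn n B \<Longrightarrow> convex_Rn n (A \<inter> B)"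
  by (auto simp: convex_Rn_def)

lemma UN_Box: "(\<Union>k. Box n (real k)) = Rn n"
proof (intro equalityI subsetI)
  fix x assume x: "x \<in> Rn n"
  obtain k :: nat where k: "(\<Sum>i<n. \<bar>x i\<bar>) \<le> real k" using real_arch_simple by blast
  have "\<bar>x i\<bar> \<le> real k" if "i < n" for i
    using member_le_sum[of i "{..<n}" "\<lambda>i. \<bar>x i\<bar>"] that k by auto
  then show "x \<in> (\<Union>k. Box n (real k))" using x by (auto simp: Box_def)
qed (auto simp: Box_def)

text \<open>A point of \<open>Q\<close> far out would drag a half-size copy of \<open>Q \<inter> Box n R\<close> into the shell.\<close>

lemma convex_shell_bounded:
  assumes Q: "Q \<in> sets (lborel_Rn n)" and cvx: "convex_Rn n Q" and o: "origin n \<in> Q" and R: "R > 0"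
    and small: "vol n (Q \<inter> (Box n (3 * R) - Box n R)) < ennreal ((1 / 2) ^ n) * vol n (Q \<inter> Box n R)"
  shows "Q \<subseteq> Box n (3 * R)"
proof (rule ccontr)
  assume "\<not> Q \<subseteq> Box n (3 * R)"
  then obtain x where x: "x \<in> Q" "x \<notin> Box n (3 * R)" by auto
  have xR: "x \<in> Rn n" using x(1) sets.sets_into_space[OF Q] by (auto simp: space_lborel_Rn)
  obtain i1 where i1: "i1 < n" "\<bar>x i1\<bar> > 3 * R" using x xR by (auto simp: Box_def not_le)
  define N where "N = Max ((\<lambda>i. \<bar>x i\<bar>) ` {..<n})"
  have "N \<in> (\<lambda>i. \<bar>x i\<bar>) ` {..<n}" unfolding N_def using i1 by (intro Max_in) auto
  then obtain i0 where i0: "i0 < n" "N = \<bar>x i0\<bar>" by auto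
  have N: "\<bar>x i\<bar> \<le> N" if "i < n" for i unfolding N_def using that by (intro Max_ge) auto
  have N3: "N > 3 * R" using N[OF i1(1)] i1(2) by linarith
  obtain y where y: "y \<in> Q" "\<And>i. i < n \<Longrightarrow> \<bar>y i\<bar> \<le> 4 * R" "\<bar>y i0\<bar> > 3 * R"
  proof (cases "N \<le> 4 * R")
    case True
    then show thesis using that[of x] x N N3 i0 by force
  next
    case False
    define l where "l = 4 * R / N"
    have l: "0 < l" "l < 1" using False R by (auto simp: l_def)
    have yi: "\<bar>mix n l (origin n) x i\<bar> = l * \<bar>x i\<bar>" if "i < n" for i
      using that l by (simp add: origin_def abs_mult)
    have lN: "l * N = 4 * R" using False R by (simp add: l_def)
    show thesis
    proof (rule that[of "mix n l (origin n) x"])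
      show "mix n l (origin n) x \<in> Q" using cvx o x l by (auto simp: convex_Rn_def)
      show "\<bar>mix n l (origin n) x i\<bar> \<le> 4 * R" if "i < n" for i
        using yi[OF that] mult_left_mono[OF N[OF that], of l] l lN by simp
      show "\<bar>mix n l (origin n) x i0\<bar> > 3 * R" using yi[OF i0(1)] i0(2) lN R by simp
    qed
  qed
  have "ennreal ((1 / 2) ^ n) * vol n (Q \<inter> Box n R) \<le> vol n (Q \<inter> (Box n (3 * R) - Box n R))"
  proof (rule vol_mix_le[where z = y])
    show "Q \<inter> (Box n (3 * R) - Box n R) \<in> sets (lborel_Rn n)" using Q by auto
    show "Q \<inter> Box n R \<subseteq> Rn n" by (auto simp: Box_def)
    fix b assume b: "b \<in> Q \<inter> Box n R"
    have "mix n (1/2) y b \<in> Q" using cvx y(1) b by (auto simp: convex_Rn_def)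
    moreover have bi: "\<bar>b i\<bar> \<le> R" if "i < n" for i using b that by (auto simp: Box_def)
    have "\<bar>mix n (1/2) y b i\<bar> \<le> 3 * R" if "i < n" for i
      using y(2)[OF that] bi[OF that] that R by simp
    then have "mix n (1/2) y b \<in> Box n (3 * R)" by (simp add: Box_def)
    moreover have "\<bar>mix n (1/2) y b i0\<bar> > R"
      using y(3) bi[OF i0(1)] i0(1) by simp
    then have "mix n (1/2) y b \<notin> Box n R" using i0(1) by (auto simp: Box_def)
    ultimately show "mix n (1/2) y b \<in> Q \<inter> (Box n (3 * R) - Box n R)" by blast
  qed simp
  with small show False by simp
qed

text \<open>The part of Q in the box of radius k tends to the full volume, so what the shell up to
  radius \<open>3 k\<close> can hold tends to 0. For large k this is what
  \<open>convex_shell_bounded\<close> asks for.\<close>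

lemma convex_finite_vol_bounded:
  assumes Q: "Q \<in> sets (lborel_Rn n)" and cvx: "convex_Rn n Q" and o: "origin n \<in> Q"
    and vol: "0 < vol n Q" "vol n Q < \<infinity>"
  obtains R where "R > 0" "Q \<subseteq> Box n R"
proof -
  let ?m = "\<lambda>k. measure (lborel_Rn n) (Q \<inter> Box n (real k))"
  let ?V = "measure (lborel_Rn n) Q"
  have fin: "emeasure (lborel_Rn n) Q \<noteq> \<infinity>" using vol by (simp add: vol_def)
  have V: "?V > 0" using vol by (simp add: vol_def measure_def enn2real_positive_iff)
  have un: "(\<Union>k. Q \<inter> Box n (real k)) = Q"
    using UN_Box[of n] sets.sets_into_space[OF Q] by (auto simp: space_lborel_Rn)
  have "?m \<longlonglongrightarrow> measure (lborel_Rn n) (\<Union>k. Q \<inter> Box n (real k))"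
  proof (rule Lim_measure_incseq)
    show "range (\<lambda>k. Q \<inter> Box n (real k)) \<subseteq> sets (lborel_Rn n)" using Q by auto
    show "incseq (\<lambda>k. Q \<inter> Box n (real k))"
      unfolding incseq_def by (intro allI impI Int_mono Box_mono order_refl) simp
  qed (use fin un in simp)
  then have L: "?m \<longlonglongrightarrow> ?V" unfolding un .
  have "(\<lambda>k. (1/2) ^ n * ?m k - (?V - ?m k)) \<longlonglongrightarrow> (1/2) ^ n * ?V - (?V - ?V)"
    by (rule tendsto_diff[OF tendsto_mult[OF tendsto_const L] tendsto_diff[OF tendsto_const L]])
  then have "eventually (\<lambda>k. (1/2) ^ n * ?m k - (?V - ?m k) > 0) sequentially"
    by (rule order_tendstoD(1)) (use V in simp)
  then have "eventually (\<lambda>k. (1/2) ^ n * ?m k - (?V - ?m k) > 0 \<and> k > 0) sequentially"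
    using eventually_gt_at_top[of 0] by eventually_elim auto
  then obtain k where k: "(1/2) ^ n * ?m k - (?V - ?m k) > 0" "k > 0"
    unfolding eventually_sequentially by blast
  have fink: "emeasure (lborel_Rn n) (Q \<inter> A) \<noteq> \<infinity>" if "A \<in> sets (lborel_Rn n)" for A
    using fin emeasure_mono[of "Q \<inter> A" Q "lborel_Rn n"] Q by (auto simp: top_unique)
  have sh: "Box n (3 * real k) - Box n (real k) \<in> sets (lborel_Rn n)" by simp
  have "measure (lborel_Rn n) (Q \<inter> (Box n (3 * real k) - Box n (real k))) + ?m k
      = measure (lborel_Rn n) (Q \<inter> (Box n (3 * real k) - Box n (real k)) \<union> Q \<inter> Box n (real k))"
    using Q fink[OF sh] fink[OF sets_Box] sh by (intro measure_Union[symmetric]) auto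
  also have "\<dots> \<le> ?V"
    using Q fin by (intro measure_mono_fmeasurable) (auto simp: fmeasurable_def less_top)
  finally have "measure (lborel_Rn n) (Q \<inter> (Box n (3 * real k) - Box n (real k))) < (1/2) ^ n * ?m k"
    using k by linarith
  then have "vol n (Q \<inter> (Box n (3 * real k) - Box n (real k))) < ennreal ((1/2) ^ n) * vol n (Q \<inter> Box n (real k))"
    unfolding vol_def using fink[OF sh] fink[OF sets_Box]
    by (simp add: emeasure_eq_ennreal_measure ennreal_mult[symmetric] ennreal_less_iff)
  then have "Q \<subseteq> Box n (3 * real k)"
    using k by (intro convex_shell_bounded[OF Q cvx o]) auto
  then show thesis using k by (intro that[of "3 * real k"]) auto
qed

text \<open>The finite intersections \<open>Q m\<close> decrease to \<open>polyh n V\<close>, which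
  misses the shell between two boxes. Inside the shell all volumes are finite, even if that of
  \<open>Q m\<close> is not, so they tend to 0 and \<open>convex_shell_bounded\<close> applies to
  some \<open>Q m\<close>.\<close>

lemma polyh_finite_subfamily_bounded:
  assumes vol: "0 < vol n (polyh n V)" "vol n (polyh n V) < \<infinity>"
  obtains F R where "finite F" "F \<subseteq> V" "polyh n F \<subseteq> Box n R"
proof -
  obtain R where R: "R > 0" "polyh n V \<subseteq> Box n R"
    using convex_finite_vol_bounded[OF sets_polyh convex_polyh origin_in_polyh vol] by blast
  obtain W where W: "W \<subseteq> V" "countable W" "polyh n W = polyh n V"
    by (rule polyh_countable_subfamily)
  show thesis
  proof (cases "W = {}")
    case True
    then show thesis using that[of "{}" R] R W by auto
  next
    case False
    define Q where "Q m = polyh n (from_nat_into W ` {..m})" for m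
    let ?sh = "Box n (3 * R) - Box n R"
    have INT: "(\<Inter>m. Q m) = polyh n V"
    proof
      show "(\<Inter>m. Q m) \<subseteq> polyh n V"
      proof
        fix x assume x: "x \<in> (\<Inter>m. Q m)"
        have "inner_Rn n x v \<le> 1" if "v \<in> W" for v
        proof -
          obtain m where "v = from_nat_into W m"
            using from_nat_into_surj[OF W(2) \<open>v \<in> W\<close>] by metis
          moreover have "x \<in> Q m" using x by auto
          ultimately show ?thesis by (auto simp: Q_def polyh_def)
        qed
        moreover have "x \<in> Rn n" using x by (auto simp: Q_def polyh_def)
        ultimately show "x \<in> polyh n V" using W(3) by (auto simp: polyh_def)
      qed
      have "from_nat_into W ` {..m} \<subseteq> W" for m using from_nat_into[OF False] by auto
      then show "polyh n V \<subseteq> (\<Inter>m. Q m)"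
        unfolding W(3)[symmetric] Q_def by (intro INT_greatest polyh_antimono)
    qed
    have finsh: "emeasure (lborel_Rn n) (Q m \<inter> ?sh) \<noteq> \<infinity>" for m
    proof -
      have "emeasure (lborel_Rn n) (Q m \<inter> ?sh) \<le> emeasure (lborel_Rn n) (Box n (3 * R))"
        by (intro emeasure_mono) auto
      then show ?thesis using emeasure_Box_finite[of n "3 * R"] by (auto simp: top_unique)
    qed
    have "(\<lambda>m. emeasure (lborel_Rn n) (Q m \<inter> ?sh)) \<longlonglongrightarrow> emeasure (lborel_Rn n) (\<Inter>m. Q m \<inter> ?sh)"
    proof (rule Lim_emeasure_decseq)
      show "range (\<lambda>m. Q m \<inter> ?sh) \<subseteq> sets (lborel_Rn n)" by (auto simp: Q_def)
      show "decseq (\<lambda>m. Q m \<inter> ?sh)"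
        unfolding decseq_def Q_def using polyh_antimono[of "from_nat_into W ` {.._}" "from_nat_into W ` {.._}" n]
        by (metis Int_mono atMost_subset_iff image_mono order_refl)
    qed (rule finsh)
    moreover have "(\<Inter>m. Q m \<inter> ?sh) = {}" using INT R by auto
    ultimately have lim: "(\<lambda>m. vol n (Q m \<inter> ?sh)) \<longlonglongrightarrow> 0" by (simp add: vol_def)
    have "0 < ennreal ((1/2) ^ n) * vol n (polyh n V)"
      using vol by (simp add: ennreal_zero_less_mult_iff)
    from order_tendstoD(2)[OF lim this]
    obtain m where m: "vol n (Q m \<inter> ?sh) < ennreal ((1/2) ^ n) * vol n (polyh n V)"
      by (auto simp: eventually_sequentially)
    also have "\<dots> \<le> ennreal ((1/2) ^ n) * vol n (Q m \<inter> Box n R)"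
      unfolding vol_def using R INT by (intro mult_left_mono emeasure_mono) (auto simp: Q_def)
    finally have "Q m \<subseteq> Box n (3 * R)"
      unfolding Q_def using R by (intro convex_shell_bounded sets_polyh convex_polyh origin_in_polyh)
    then show thesis
      using W(1) from_nat_into[OF False] unfolding Q_def
      by (intro that[of "from_nat_into W ` {..m}" "3 * R"]) auto
  qed
qed

section \<open>The uniform distribution on a convex body\<close>

definition uniform_on :: "nat \<Rightarrow> (nat \<Rightarrow> real) set \<Rightarrow> (nat \<Rightarrow> real) measure" where
  "uniform_on n Q = scale_measure (inverse (vol n Q)) (restrict_space (lborel_Rn n) Q)"

locale convex_body =
  fixes n :: nat and Q :: "(nat \<Rightarrow> real) set" and R :: real
  assumes sets_Q [measurable]: "Q \<in> sets (lborel_Rn n)"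
    and convex_Q: "convex_Rn n Q"
    and Q_Box: "Q \<subseteq> Box n R"
    and vol_pos: "0 < vol n Q"
begin

abbreviation "U \<equiv> uniform_on n Q"
abbreviation "\<mu> \<equiv> measure (lborel_Rn n)"

definition centroid :: "nat \<Rightarrow> real" where
  "centroid = (\<lambda>i\<in>{..<n}. \<integral>x. x i \<partial>U)"

definition dev :: "(nat \<Rightarrow> real) \<Rightarrow> (nat \<Rightarrow> real) \<Rightarrow> real" where
  "dev v x = inner_Rn n x v - inner_Rn n centroid v"

lemma Q_subset_Rn: "Q \<subseteq> Rn n" using Q_Box Box_subset_Rn by blast

lemma vol_finite: "vol n Q < \<infinity>"
  using emeasure_mono[OF Q_Box, of "lborel_Rn n"] emeasure_Box_finite[of n R]
  unfolding vol_def by (auto intro: le_less_trans)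

lemma vol_subset_eq: "A \<subseteq> Q \<Longrightarrow> A \<in> sets (lborel_Rn n) \<Longrightarrow> vol n A = ennreal (\<mu> A)"
  using emeasure_mono[of A Q "lborel_Rn n"] vol_finite
  unfolding vol_def by (intro emeasure_eq_ennreal_measure) (auto simp: top_unique)

lemma vol_Q: "vol n Q = ennreal (\<mu> Q)" by (rule vol_subset_eq) auto

lemma measure_pos: "0 < \<mu> Q" using vol_pos vol_Q by (simp add: ennreal_less_zero_iff)

lemma space_U [simp]: "space U = Q"
  using Q_subset_Rn unfolding uniform_on_def space_scale_measure space_restrict_space space_lborel_Rn by blast

lemma measurable_U: "f \<in> borel_measurable (lborel_Rn n) \<Longrightarrow> f \<in> borel_measurable U"
proof -
  assume "f \<in> borel_measurable (lborel_Rn n)"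
  then have "f \<in> borel_measurable (restrict_space (lborel_Rn n) Q)"
    by (rule measurable_restrict_space1)
  moreover have "sets U = sets (restrict_space (lborel_Rn n) Q)"
    by (simp add: uniform_on_def)
  ultimately show ?thesis
    using measurable_cong_sets[of U "restrict_space (lborel_Rn n) Q" borel borel] by blast
qed

lemma emeasure_U: "A \<in> sets (lborel_Rn n) \<Longrightarrow> A \<subseteq> Q \<Longrightarrow> emeasure U A = ennreal (\<mu> A / \<mu> Q)"
  using measure_pos
  by (simp add: uniform_on_def emeasure_restrict_space vol_Q vol_subset_eq[unfolded vol_def]
      inverse_ennreal ennreal_mult[symmetric] divide_inverse mult.commute)

lemma measure_U: "A \<in> sets (lborel_Rn n) \<Longrightarrow> A \<subseteq> Q \<Longrightarrow> measure U A = \<mu> A / \<mu> Q"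
  using measure_pos by (simp add: measure_def[of U] emeasure_U)

sublocale prob_space U
  using measure_pos emeasure_U[of Q] by (intro prob_spaceI) auto

lemma prob_Q: "prob Q = 1"
  using prob_space by simp

lemma sets_Collect_Q:
  assumes [measurable]: "f \<in> borel_measurable (lborel_Rn n)"
  shows "{x\<in>Q. c < f x} \<in> sets (lborel_Rn n)" "{x\<in>Q. f x \<noteq> (c::real)} \<in> sets (lborel_Rn n)"
    "{x\<in>Q. f x = (c::real)} \<in> sets (lborel_Rn n)"
proof -
  have eq: "{x\<in>Q. P x} = {x\<in>space (lborel_Rn n). x \<in> Q \<and> P x}" for P
    using sets.sets_into_space[OF sets_Q] by auto
  show "{x\<in>Q. c < f x} \<in> sets (lborel_Rn n)" "{x\<in>Q. f x \<noteq> c} \<in> sets (lborel_Rn n)"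
    "{x\<in>Q. f x = c} \<in> sets (lborel_Rn n)"
    unfolding eq by measurable
qed

lemma measurable_dev [measurable]: "dev v \<in> borel_measurable (lborel_Rn n)"
  unfolding dev_def[abs_def] by measurable

lemma measurable_dev_U [measurable]: "dev v \<in> borel_measurable U"
  by (intro measurable_U measurable_dev)

lemma dev_mix: "dev v (mix n l x y) = (1 - l) * dev v x + l * dev v y"
  by (simp add: dev_def inner_Rn_mix algebra_simps)

lemma dev_centroid [simp]: "dev v centroid = 0"
  by (simp add: dev_def)

lemma coord_bound: "x \<in> Q \<Longrightarrow> i < n \<Longrightarrow> \<bar>x i\<bar> \<le> R"
  using Q_Box by (auto simp: Box_def)

lemma integrable_coord: "i < n \<Longrightarrow> integrable U (\<lambda>x. x i)"
  using coord_bound by (intro bounded_integrable[where C=R] measurable_U measurable_coord) auto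

lemma dev_bounded: obtains K where "\<And>x. x \<in> Q \<Longrightarrow> \<bar>dev v x\<bar> \<le> K"
proof
  fix x assume x: "x \<in> Q"
  have "\<bar>inner_Rn n x v\<bar> \<le> (\<Sum>i<n. \<bar>x i * v i\<bar>)" unfolding inner_Rn_def by (rule sum_abs)
  also have "\<dots> \<le> (\<Sum>i<n. R * \<bar>v i\<bar>)"
    using coord_bound[OF x] by (intro sum_mono) (auto simp: abs_mult intro: mult_right_mono)
  finally show "\<bar>dev v x\<bar> \<le> (\<Sum>i<n. R * \<bar>v i\<bar>) + \<bar>inner_Rn n centroid v\<bar>"
    unfolding dev_def by linarith
qed

lemma integrable_dev: "integrable U (dev v)"
proof -
  obtain K where "\<And>x. x \<in> Q \<Longrightarrow> \<bar>dev v x\<bar> \<le> K" using dev_bounded by blast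
  then show ?thesis by (intro bounded_integrable[where C=K]) auto
qed

lemma integrable_dev_mult: "integrable U (\<lambda>x. dev v x * dev w x)"
proof -
  obtain K where K: "\<And>x. x \<in> Q \<Longrightarrow> \<bar>dev v x\<bar> \<le> K" using dev_bounded by blast
  obtain L where L: "\<And>x. x \<in> Q \<Longrightarrow> \<bar>dev w x\<bar> \<le> L" using dev_bounded by blast
  have "\<bar>dev v x * dev w x\<bar> \<le> K * L" if "x \<in> Q" for x
    using K[OF that] L[OF that] abs_ge_zero[of "dev v x"] unfolding abs_mult
    by (intro mult_mono) linarith+
  then show ?thesis by (intro bounded_integrable[where C="K * L"]) auto
qed

lemma expectation_dev: "expectation (dev v) = 0"
proof -
  have "expectation (dev v) = (\<Sum>i<n. expectation (\<lambda>x. x i) * v i) - inner_Rn n centroid v"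
    unfolding dev_def[abs_def] inner_Rn_def
    using integrable_coord by (subst Bochner_Integration.integral_diff) (auto simp: prob_Q)
  then show ?thesis by (simp add: inner_Rn_def centroid_def)
qed

lemma log_concave_tail_affine:
  assumes t: "t \<in> borel_measurable (lborel_Rn n)"
    and aff: "\<And>l x y. t (mix n l x y) = (1 - l) * t x + l * t y"
  shows "log_concave_tail U t"
  unfolding log_concave_tail_def
proof (intro allI impI)
  fix b u w :: real assume "0 \<le> u" "0 \<le> w"
  from tail_submultiplicative[OF sets_Q Q_Box convex_Q t aff this]
  show "prob {x\<in>space U. b + u + w < t x} * prob {x\<in>space U. b < t x}
     \<le> prob {x\<in>space U. b + u < t x} * prob {x\<in>space U. b + w < t x}"
    using measure_pos by (simp add: measure_U sets_Collect_Q[OF t] divide_right_mono)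
qed

lemma log_concave_tail_dev: "log_concave_tail U (dev v)" "log_concave_tail U (\<lambda>x. - dev v x)"
  by (auto intro!: log_concave_tail_affine simp: dev_mix algebra_simps)

text \<open>If \<open>dev v\<close> vanished almost everywhere, the half-size copy of its zero set centred at a
  point \<open>y\<close> off the zero set would lie in the complement.\<close>

lemma dev_nonzero:
  assumes y: "y \<in> Q" "dev v y \<noteq> 0"
  shows "\<not> (AE x in U. dev v x = 0)"
proof
  assume "AE x in U. dev v x = 0"
  let ?B = "{x\<in>Q. dev v x \<noteq> 0}" and ?A = "{x\<in>Q. dev v x = 0}"
  have [measurable]: "?A \<in> sets (lborel_Rn n)" "?B \<in> sets (lborel_Rn n)"
    by (intro sets_Collect_Q measurable_dev)+
  have "{x\<in>space U. dev v x \<noteq> 0} \<in> events" by measurable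
  then have "?B \<in> events" by simp
  then have "prob ?B = 0"
    using \<open>AE x in U. dev v x = 0\<close> by (subst prob_eq_0) (auto elim: AE_mp)
  then have B0: "\<mu> ?B = 0" using measure_pos by (simp add: measure_U)
  have "ennreal ((1/2) ^ n) * vol n ?A \<le> vol n ?B"
  proof (rule vol_mix_le[where z = y])
    fix x assume "x \<in> ?A"
    then show "mix n (1/2) y x \<in> ?B"
      using convex_Q y by (auto simp: convex_Rn_def dev_mix)
  qed (use Q_subset_Rn in auto)
  then have "vol n ?A = 0" using B0 by (simp add: vol_subset_eq)
  then have A0: "\<mu> ?A = 0" by (simp add: vol_subset_eq)
  have "\<mu> Q \<le> \<mu> ?A + \<mu> ?B"
    using measure_Un_le[of ?A "lborel_Rn n" ?B] by (simp add: Collect_disj_eq[symmetric] conj_disj_distribL[symmetric])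
  then show False using A0 B0 measure_pos by simp
qed

end

section \<open>Isotropic position and volume comparison\<close>

text \<open>Vectors are bare functions here, of which \<open>pos\<close> sees only the first n
  values. The matrix c, writing unit vectors in terms of b, says that b is a basis; the vanishing of
  \<open>b i l\<close> for \<open>l \<ge> k\<close> keeps the next unit vector independent of the
  earlier \<open>b i\<close>.\<close>

lemma Gram_Schmidt:
  fixes B :: "(nat \<Rightarrow> real) \<Rightarrow> (nat \<Rightarrow> real) \<Rightarrow> real"
  assumes sym: "\<And>u v. B u v = B v u"
    and lin: "\<And>(S :: nat set) a f w. finite S \<Longrightarrow> B (\<lambda>l. \<Sum>j\<in>S. a j * f j l) w = (\<Sum>j\<in>S. a j * B (f j) w)"
    and pos: "\<And>v i. i < n \<Longrightarrow> v i \<noteq> 0 \<Longrightarrow> B v v > 0"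
    and "k \<le> n"
  shows "\<exists>b c. (\<forall>i<k. \<forall>j<k. B (b i) (b j) = of_bool (i = j)) \<and> (\<forall>i<k. \<forall>l\<ge>k. b i l = 0) \<and>
    (\<forall>i<k. \<forall>l. of_bool (l = i) = (\<Sum>j<k. c i j * b j l))"
  using \<open>k \<le> n\<close>
proof (induction k)
  case (Suc k)
  then have "k \<le> n" by simp
  from Suc.IH[OF this] obtain b c
    where IH: "\<forall>i<k. \<forall>j<k. B (b i) (b j) = of_bool (i = j)" "\<forall>i<k. \<forall>l\<ge>k. b i l = 0"
      "\<forall>i<k. \<forall>l. of_bool (l = i) = (\<Sum>j<k. c i j * b j l)"
    by (elim exE conjE)
  have orth: "B (b i) (b j) = of_bool (i = j)" if "i < k" "j < k" for i j using IH(1) that by blast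
  have supp: "b i l = 0" if "i < k" "k \<le> l" for i l using IH(2) that by blast
  have span: "of_bool (l = i) = (\<Sum>j<k. c i j * b j l)" if "i < k" for i l using IH(3) that by blast
  \<comment> \<open>The unit vector to be orthogonalised. Its residual u is first written as a
    single finite sum, the form in which \<open>lin\<close> applies.\<close>
  define e :: "nat \<Rightarrow> real" where "e l = of_bool (l = k)" for l
  define a where "a j = (if j = k then 1 else - B e (b j))" for j
  define f where "f j = (if j = k then e else b j)" for j
  define u where "u l = (\<Sum>j\<in>{..k}. a j * f j l)" for l
  have u_eq: "u l = e l - (\<Sum>j<k. B e (b j) * b j l)" for l
    by (simp add: u_def atMost_Suc lessThan_Suc_atMost[symmetric] a_def f_def sum_negf)
  have Bu: "B u w = B e w - (\<Sum>j<k. B e (b j) * B (b j) w)" for w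
  proof -
    have "B u w = (\<Sum>j\<in>{..k}. a j * B (f j) w)"
      unfolding u_def[abs_def] by (rule lin) simp
    then show ?thesis
      by (simp add: lessThan_Suc_atMost[symmetric] a_def f_def sum_negf)
  qed
  \<comment> \<open>The earlier \<open>b j\<close> vanish at index k, so the residual is
    nonzero.\<close>
  have "u k = 1" using supp by (simp add: u_eq e_def)
  then have s: "B u u > 0" using Suc.prems by (intro pos[of k]) auto
  define r where "r = sqrt (B u u)"
  have r: "r > 0" "r * r = B u u" using s by (auto simp: r_def)
  define bk where "bk l = u l / r" for l
  have Bbk: "B bk w = B u w / r" for w
  proof -
    have "bk = (\<lambda>l. \<Sum>j\<in>{0::nat}. (1 / r) * u l)" by (simp add: bk_def fun_eq_iff)
    then show ?thesis using lin[of "{0}" "\<lambda>_. 1 / r" "\<lambda>_. u" w] by simp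
  qed
  have Bub: "B u (b i) = 0" if "i < k" for i
  proof -
    have "(\<Sum>j<k. B e (b j) * B (b j) (b i)) = (\<Sum>j<k. if j = i then B e (b i) else 0)"
      using orth that by (intro sum.cong) auto
    then show ?thesis using that by (simp add: Bu)
  qed
  define b' where "b' = b(k := bk)"
  \<comment> \<open>Row k is the equation for the residual, \<open>r * bk\<close>, solved for
    e.\<close>
  define c' where "c' i j = (if i = k then (if j = k then r else B e (b j)) else if j = k then 0 else c i j)" for i j
  have "B (b' i) (b' j) = of_bool (i = j)" if "i < Suc k" "j < Suc k" for i j
  proof -
    have "B u bk = B u u / r" by (simp add: sym[of u bk] Bbk)
    also have "\<dots> = r" using r by (simp add: r(2)[symmetric])
    finally have "B bk bk = 1" using r by (simp add: Bbk)
    moreover have "B bk (b i) = 0" "B (b i) bk = 0" if "i < k" for i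
      using Bub[OF that] Bbk sym[of "b i" bk] by auto
    ultimately show ?thesis using that orth by (auto simp: b'_def less_Suc_eq)
  qed
  moreover have "b' i l = 0" if "i < Suc k" "Suc k \<le> l" for i l
    using that supp by (auto simp: b'_def bk_def u_eq e_def)
  moreover have "of_bool (l = i) = (\<Sum>j<Suc k. c' i j * b' j l)" if "i < Suc k" for i l
  proof (cases "i = k")
    case True
    have "(\<Sum>j<Suc k. c' i j * b' j l) = (\<Sum>j<k. B e (b j) * b j l) + u l"
      using r True by (simp add: c'_def b'_def bk_def)
    then show ?thesis using True by (simp add: u_eq e_def)
  next
    case False
    then have "(\<Sum>j<Suc k. c' i j * b' j l) = (\<Sum>j<k. c i j * b j l)"
      by (simp add: c'_def b'_def)
    then show ?thesis using span[of i l] that False by simp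
  qed
  ultimately show ?case by blast
qed auto

context convex_body
begin

lemma dev_cong: "(\<And>i. i < n \<Longrightarrow> v i = w i) \<Longrightarrow> dev v x = dev w x"
  by (simp add: dev_def inner_Rn_def)

lemma dev_sum:
  "dev (\<lambda>l. \<Sum>j\<in>S. a j * f j l) x = (\<Sum>j\<in>S. a j * dev (f j) x)"
proof -
  have "inner_Rn n y (\<lambda>l. \<Sum>j\<in>S. a j * f j l) = (\<Sum>j\<in>S. a j * inner_Rn n y (f j))" for y
  proof -
    have "inner_Rn n y (\<lambda>l. \<Sum>j\<in>S. a j * f j l) = (\<Sum>i<n. \<Sum>j\<in>S. y i * (a j * f j i))"
      unfolding inner_Rn_def by (simp add: sum_distrib_left)
    also have "\<dots> = (\<Sum>j\<in>S. \<Sum>i<n. y i * (a j * f j i))" by (rule sum.swap)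
    also have "\<dots> = (\<Sum>j\<in>S. a j * inner_Rn n y (f j))"
      unfolding inner_Rn_def by (simp add: sum_distrib_left mult.left_commute)
    finally show ?thesis .
  qed
  then show ?thesis by (simp add: dev_def sum_subtractf right_diff_distrib)
qed

text \<open>\<open>(\<lambda>x. (dev (b 0) x, \<dots>, dev (b (n - 1)) x))\<close> puts \<open>Q\<close> into isotropic position.\<close>

lemma isotropic_coordinates:
  assumes nondeg: "\<And>v. \<exists>i<n. v i \<noteq> 0 \<Longrightarrow> \<not> (AE x in U. dev v x = 0)"
  obtains b where "expectation (\<lambda>x. \<Sum>i<n. (dev (b i) x)\<^sup>2) = real n"
    and "\<And>v x. (dev v x)\<^sup>2 \<le> expectation (\<lambda>x. (dev v x)\<^sup>2) * (\<Sum>i<n. (dev (b i) x)\<^sup>2)"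
proof -
  define B where "B v w = expectation (\<lambda>x. dev v x * dev w x)" for v w
  have "\<exists>b c. (\<forall>i<n. \<forall>j<n. B (b i) (b j) = of_bool (i = j)) \<and> (\<forall>i<n. \<forall>l\<ge>n. b i l = 0) \<and>
    (\<forall>i<n. \<forall>l. of_bool (l = i) = (\<Sum>j<n. c i j * b j l))"
  proof (rule Gram_Schmidt)
    fix u v show "B u v = B v u" by (simp add: B_def mult.commute)
  next
    fix S :: "nat set" and a and f :: "nat \<Rightarrow> nat \<Rightarrow> real" and w assume "finite S"
    show "B (\<lambda>l. \<Sum>j\<in>S. a j * f j l) w = (\<Sum>j\<in>S. a j * B (f j) w)"
      unfolding B_def dev_sum using integrable_dev_mult
      by (simp add: sum_distrib_right mult.assoc)
  next
    fix v and i assume v: "i < n" "v i \<noteq> (0::real)"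
    have "0 \<le> B v v" by (simp add: B_def)
    moreover have "B v v \<noteq> 0"
    proof
      assume "B v v = 0"
      then have "AE x in U. dev v x * dev v x = 0"
        using integral_nonneg_eq_0_iff_AE[OF integrable_dev_mult[of v v]] by (simp add: B_def)
      then show False using nondeg[of v] v by auto
    qed
    ultimately show "B v v > 0" by simp
  qed simp
  then obtain b c where bc: "\<forall>i<n. \<forall>j<n. B (b i) (b j) = of_bool (i = j)"
      "\<forall>i<n. \<forall>l. of_bool (l = i) = (\<Sum>j<n. c i j * b j l)"
    by (elim exE conjE)
  have orth: "B (b i) (b j) = of_bool (i = j)" if "i < n" "j < n" for i j using bc(1) that by blast
  have span: "of_bool (l = i) = (\<Sum>j<n. c i j * b j l)" if "i < n" for i l using bc(2) that by blast
  show thesis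
  proof (rule that[of b])
    have "expectation (\<lambda>x. \<Sum>i<n. (dev (b i) x)\<^sup>2) = (\<Sum>i<n. B (b i) (b i))"
      unfolding B_def power2_eq_square using integrable_dev_mult by simp
    also have "\<dots> = real n" using orth by simp
    finally show "expectation (\<lambda>x. \<Sum>i<n. (dev (b i) x)\<^sup>2) = real n" .
  next
    fix v x
    \<comment> \<open>The coordinates of v in the basis b. By orthonormality their squares sum to
      the second moment of \<open>dev v\<close>, so the claim becomes Cauchy-Schwarz.\<close>
    define d where "d j = (\<Sum>i<n. v i * c i j)" for j
    have dev_v: "dev v x = (\<Sum>j<n. d j * dev (b j) x)" for x
    proof -
      have "v l = (\<Sum>j<n. d j * b j l)" if "l < n" for l
      proof -
        have "v l = (\<Sum>i<n. if i = l then v l else 0)" using that by simp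
        also have "\<dots> = (\<Sum>i<n. v i * of_bool (l = i))" by (intro sum.cong) auto
        also have "\<dots> = (\<Sum>i<n. v i * (\<Sum>j<n. c i j * b j l))" using span by simp
        also have "\<dots> = (\<Sum>i<n. \<Sum>j<n. v i * c i j * b j l)"
          by (simp add: sum_distrib_left mult.assoc)
        also have "\<dots> = (\<Sum>j<n. \<Sum>i<n. v i * c i j * b j l)" by (rule sum.swap)
        also have "\<dots> = (\<Sum>j<n. d j * b j l)" by (simp add: d_def sum_distrib_right)
        finally show ?thesis .
      qed
      then have "dev v x = dev (\<lambda>l. \<Sum>j<n. d j * b j l) x" by (rule dev_cong)
      then show ?thesis by (simp add: dev_sum)
    qed
    have "expectation (\<lambda>x. (dev v x)\<^sup>2) = expectation (\<lambda>x. \<Sum>i<n. \<Sum>j<n. (d i * d j) * (dev (b i) x * dev (b j) x))"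
      by (intro Bochner_Integration.integral_cong)
         (simp_all add: dev_v power2_eq_square sum_product mult_ac)
    also have "\<dots> = (\<Sum>i<n. \<Sum>j<n. (d i * d j) * B (b i) (b j))"
      unfolding B_def using integrable_dev_mult by simp
    also have "\<dots> = (\<Sum>i<n. \<Sum>j<n. if i = j then (d i)\<^sup>2 else 0)"
      using orth by (intro sum.cong) (auto simp: power2_eq_square)
    also have "\<dots> = (\<Sum>i<n. (d i)\<^sup>2)" by simp
    finally have "expectation (\<lambda>x. (dev v x)\<^sup>2) = (\<Sum>i<n. (d i)\<^sup>2)" .
    then show "(dev v x)\<^sup>2 \<le> expectation (\<lambda>x. (dev v x)\<^sup>2) * (\<Sum>i<n. (dev (b i) x)\<^sup>2)"
      unfolding dev_v using Cauchy_Schwarz_ineq_sum[of d "\<lambda>j. dev (b j) x" "{..<n}"] by simp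
  qed
qed

section \<open>Comparing the volumes of Q and of a polyhedron\<close>

text \<open>The number \<open>\<tau>\<close> of the overview: the level of the bounding hyperplane,
  measured from the centroid.\<close>

definition gap :: "(nat \<Rightarrow> real) \<Rightarrow> real" where
  "gap v = 1 - inner_Rn n centroid v"

lemma inner_le_1_iff: "inner_Rn n x v \<le> 1 \<longleftrightarrow> dev v x \<le> gap v"
  by (simp add: dev_def gap_def)

text \<open>N is the squared isotropic norm, of mean n, so by Markov the set
  \<open>N < n + 1\<close> has share at least \<open>1 / (n + 1)\<close> in Q. On it
  \<open>dev v \<le> L * gap v * sqrt (n + 1)\<close> for all v in V, so shrinking this part of Q
  towards the centroid by \<open>L * sqrt (n + 1)\<close> moves it into
  \<open>polyh n V\<close>.\<close>

lemma vol_le_of_second_moments: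
  assumes nondeg: "\<And>v. \<exists>i<n. v i \<noteq> 0 \<Longrightarrow> \<not> (AE x in U. dev v x = 0)"
    and L: "L > 0"
    and V: "\<And>v. v \<in> V \<Longrightarrow> 0 < gap v" "\<And>v. v \<in> V \<Longrightarrow> expectation (\<lambda>x. (dev v x)\<^sup>2) \<le> L\<^sup>2 * (gap v)\<^sup>2"
  shows "ennreal (\<mu> Q / (real n + 1) / (L * sqrt (real n + 1)) ^ n) \<le> vol n (polyh n V)"
proof -
  obtain b where bn: "expectation (\<lambda>x. \<Sum>i<n. (dev (b i) x)\<^sup>2) = real n"
    and bd: "\<And>v x. (dev v x)\<^sup>2 \<le> expectation (\<lambda>x. (dev v x)\<^sup>2) * (\<Sum>i<n. (dev (b i) x)\<^sup>2)"
    using isotropic_coordinates[OF nondeg] by blast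
  define N where "N x = (\<Sum>i<n. (dev (b i) x)\<^sup>2)" for x
  have N0: "0 \<le> N x" for x by (simp add: N_def sum_nonneg)
  have Nm [measurable]: "N \<in> borel_measurable (lborel_Rn n)"
    unfolding N_def[abs_def] by measurable
  have NU [measurable]: "N \<in> borel_measurable U" by (rule measurable_U) measurable
  have Ni: "integrable U N"
    unfolding N_def[abs_def] power2_eq_square using integrable_dev_mult by simp
  \<comment> \<open>Negated on both sides to match the form \<open>c < f x\<close> of
    \<open>sets_Collect_Q\<close>.\<close>
  let ?A = "{x\<in>Q. - (real n + 1) < - N x}"
  have As: "?A \<in> sets (lborel_Rn n)" by (intro sets_Collect_Q) measurable
  have "prob {x\<in>space U. real n + 1 \<le> N x} \<le> expectation N / (real n + 1)"
    using N0 Ni by (intro integral_Markov_inequality_measure[where A="{}"]) auto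
  also have "expectation N = real n" using bn by (simp add: N_def[abs_def])
  finally have 1: "prob {x\<in>space U. real n + 1 \<le> N x} \<le> real n / (real n + 1)" .
  have "?A = space U - {x\<in>space U. real n + 1 \<le> N x}" by auto
  moreover have "{x\<in>space U. real n + 1 \<le> N x} \<in> events" by measurable
  ultimately have "prob ?A = 1 - prob {x\<in>space U. real n + 1 \<le> N x}"
    by (simp only: prob_compl)
  with 1 have "1 - real n / (real n + 1) \<le> prob ?A" by linarith
  moreover have "1 - real n / (real n + 1) = 1 / (real n + 1)" by (simp add: field_simps)
  ultimately have "1 / (real n + 1) \<le> \<mu> ?A / \<mu> Q" using measure_U[OF As] by auto
  then have A: "\<mu> Q / (real n + 1) \<le> \<mu> ?A" using measure_pos by (simp add: field_simps)
  define r where "r = 1 / (L * sqrt (real n + 1))"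
  have r: "r > 0" using L by (simp add: r_def)
  have "ennreal (r ^ n) * vol n ?A \<le> vol n (polyh n V)"
  proof (rule vol_mix_le[OF r sets_polyh, where z = centroid])
    show "?A \<subseteq> Rn n" using Q_subset_Rn by auto
    fix x assume x: "x \<in> ?A"
    have "dev v (mix n r centroid x) \<le> gap v" if v: "v \<in> V" for v
    proof -
      have "(dev v x)\<^sup>2 \<le> expectation (\<lambda>x. (dev v x)\<^sup>2) * N x" using bd by (simp add: N_def)
      also have "\<dots> \<le> (L\<^sup>2 * (gap v)\<^sup>2) * (real n + 1)"
        using V(2)[OF v] N0[of x] x by (intro mult_mono) auto
      also have "\<dots> = (L * gap v * sqrt (real n + 1))\<^sup>2" by (simp add: power_mult_distrib)
      finally have "dev v x \<le> L * gap v * sqrt (real n + 1)"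
        using V(1)[OF v] L by (intro power2_le_imp_le[of "dev v x"]) auto
      then have "r * dev v x \<le> r * (L * gap v * sqrt (real n + 1))"
        using r by (intro mult_left_mono) auto
      also have "\<dots> = gap v" using L by (simp add: r_def)
      finally show ?thesis by (simp add: dev_mix)
    qed
    then show "mix n r centroid x \<in> polyh n V" by (simp add: polyh_def inner_le_1_iff)
  qed
  moreover have "ennreal (r ^ n) * vol n ?A = ennreal (r ^ n * \<mu> ?A)"
    using r As by (subst vol_subset_eq) (auto simp: ennreal_mult)
  ultimately have "ennreal (r ^ n * \<mu> ?A) \<le> vol n (polyh n V)" by simp
  moreover have "\<mu> Q / (real n + 1) / (L * sqrt (real n + 1)) ^ n \<le> r ^ n * \<mu> ?A"
    using A r mult_left_mono[OF A, of "r ^ n"] by (simp add: r_def power_divide mult.commute)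
  then have "ennreal (\<mu> Q / (real n + 1) / (L * sqrt (real n + 1)) ^ n) \<le> ennreal (r ^ n * \<mu> ?A)"
    by (rule ennreal_leI)
  ultimately show ?thesis by (rule order_trans[rotated])
qed

text \<open>\<open>second_moment_le\<close> needs a positive gap. Otherwise the cut would contain
  the set where \<open>dev v > 0\<close>, whose share is at least 1/6 by \<open>prob_pos_ge\<close>,
  against \<open>p \<le> 1 / 12\<close>.\<close>

lemma cut_second_moment:
  assumes nondeg: "\<And>v. \<exists>i<n. v i \<noteq> 0 \<Longrightarrow> \<not> (AE x in U. dev v x = 0)"
    and p: "\<mu> {x\<in>Q. 1 < inner_Rn n x v} \<le> p * \<mu> Q" "p \<le> 1 / 12"
  shows "0 < gap v" "expectation (\<lambda>x. (dev v x)\<^sup>2) \<le> (1 + 20 * p) * (gap v)\<^sup>2"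
proof -
  obtain K where K: "\<And>x. x \<in> space U \<Longrightarrow> \<bar>dev v x\<bar> \<le> K" using dev_bounded[of v] by auto
  have "{x\<in>Q. 1 < inner_Rn n x v} = {x\<in>space U. gap v < dev v x}"
    by (auto simp: dev_def gap_def)
  moreover have "{x\<in>Q. gap v < dev v x} \<in> sets (lborel_Rn n)" by (intro sets_Collect_Q) measurable
  ultimately have prob: "prob {x\<in>space U. gap v < dev v x} \<le> p"
    using p(1) measure_pos by (simp add: measure_U pos_divide_le_eq)
  show gap: "0 < gap v"
  proof (rule ccontr)
    assume g: "\<not> 0 < gap v"
    \<comment> \<open>A vector vanishing on \<open>{..<n}\<close> has gap 1, so v is not
      one.\<close>
    then have "(\<Sum>i<n. centroid i * v i) \<noteq> 0" by (auto simp: gap_def inner_Rn_def)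
    moreover have "(\<Sum>i<n. centroid i * v i) = 0" if "\<And>i. i < n \<Longrightarrow> v i = 0"
      using that by (intro sum.neutral) auto
    ultimately have "\<exists>i<n. v i \<noteq> 0" by blast
    then have "\<not> (AE x in U. dev v x = 0)" by (rule nondeg)
    from prob_pos_ge[OF measurable_dev_U K log_concave_tail_dev(1) expectation_dev this]
    have "1 / 6 \<le> prob {x\<in>space U. 0 < dev v x}" .
    also have "\<dots> \<le> prob {x\<in>space U. gap v < dev v x}"
    proof (rule finite_measure_mono)
      show "{x\<in>space U. gap v < dev v x} \<in> events" by measurable
    qed (use g in auto)
    finally show False using prob p(2) by simp
  qed
  show "expectation (\<lambda>x. (dev v x)\<^sup>2) \<le> (1 + 20 * p) * (gap v)\<^sup>2"
    by (rule second_moment_le[OF measurable_dev_U K log_concave_tail_dev expectation_dev gap prob p(2)])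
qed

end

section \<open>Dropping a half-space\<close>

locale polyhedral_body = convex_body n "polyh n F" R for n F R +
  assumes finite_F: "finite F"
begin

text \<open>The polyhedron contains the origin and, as F is finite, a point \<open>\<eta>\<close>
  further along axis i. There \<open>dev v\<close> differs by \<open>\<eta> * v i\<close>, so it is
  nonzero at one of them and \<open>dev_nonzero\<close> applies.\<close>

lemma nondegenerate:
  assumes "\<exists>i<n. v i \<noteq> 0"
  shows "\<not> (AE x in U. dev v x = 0)"
proof -
  obtain i where i: "i < n" "v i \<noteq> 0" using assms by blast
  define \<eta> where "\<eta> = 1 / (1 + (\<Sum>w\<in>F. \<bar>w i\<bar>))"
  have S: "0 \<le> (\<Sum>w\<in>F. \<bar>w i\<bar>)" by (simp add: sum_nonneg)
  have \<eta>: "\<eta> > 0" unfolding \<eta>_def by (intro divide_pos_pos add_pos_nonneg S) auto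
  define y where "y = (\<lambda>j\<in>{..<n}. if j = i then \<eta> else 0)"
  have inner_y: "inner_Rn n y w = \<eta> * w i" for w
  proof -
    have "inner_Rn n y w = (\<Sum>j<n. if j = i then \<eta> * w i else 0)"
      unfolding inner_Rn_def y_def by (intro sum.cong) auto
    then show ?thesis using i by simp
  qed
  have "inner_Rn n y w \<le> 1" if "w \<in> F" for w
  proof -
    have "w i \<le> 1 + (\<Sum>w\<in>F. \<bar>w i\<bar>)"
      using member_le_sum[of w F "\<lambda>w. \<bar>w i\<bar>"] that finite_F by auto
    then have "\<eta> * w i \<le> \<eta> * (1 + (\<Sum>w\<in>F. \<bar>w i\<bar>))" using \<eta> by (intro mult_left_mono) auto
    also have "\<dots> = 1" using S unfolding \<eta>_def by (simp add: add_nonneg_eq_0_iff)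
    finally show ?thesis by (simp add: inner_y)
  qed
  then have y: "y \<in> polyh n F" by (simp add: polyh_def y_def Rn_def)
  have "dev v y - dev v (origin n) = \<eta> * v i" by (simp add: dev_def inner_y)
  then have "dev v y \<noteq> 0 \<or> dev v (origin n) \<noteq> 0" using \<eta> i by auto
  then show ?thesis using dev_nonzero y origin_in_polyh by blast
qed

text \<open>A half-space of the family itself cuts off nothing, the case
  \<open>p = 0\<close>.\<close>

lemma gap_pos: assumes v: "v \<in> F" shows "0 < gap v"
proof (rule cut_second_moment(1)[OF nondegenerate, where p = 0])
  have "{x\<in>polyh n F. 1 < inner_Rn n x v} = {}" using v by (force simp: polyh_def)
  then show "\<mu> {x\<in>polyh n F. 1 < inner_Rn n x v} \<le> 0 * \<mu> (polyh n F)"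
    by (simp only: measure_empty mult_zero_left order_refl)
qed auto

text \<open>\<open>D j\<close> is the part of the cone over the facet of \<open>j\<close> inside \<open>polyh n F\<close>.  The slab \<open>S\<close> of width
  \<open>1 / n\<close> beyond that facet lies in a dilation of \<open>D j\<close>, so it is thin if \<open>D j\<close> is; log-concavity of
  the tail \<open>G\<close> between the levels \<open>-1\<close> and \<open>1\<close> then bounds everything beyond the facet.
  The truncation by \<open>Box n T\<close> is there because the region beyond the facet is not yet known to
  have finite volume.\<close>

lemma truncated_removal:
  assumes n: "n \<ge> 1" and N: "8 * real n < real (card F)"
  obtains j where "j \<in> F"
    "\<And>T. polyh n F \<subseteq> Box n T \<Longrightarrow> vol n (polyh n (F - {j}) \<inter> Box n T)
       \<le> ennreal (real (card F) / (real (card F) - 8 * real n) * \<mu> (polyh n F))"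
proof -
  let ?Q = "polyh n F"
  define N where "N = real (card F)"
  define V where "V = \<mu> ?Q"
  have V: "V > 0" using measure_pos by (simp add: V_def)
  have N8: "8 * real n < N" using N by (simp add: N_def)
  then have N0: "N > 0" by linarith
  \<comment> \<open>Normalised so that the centroid is at level 0 and every facet at level
    1.\<close>
  define el where "el v x = dev v x / gap v" for v x
  have el_mix: "el v (mix n l x y) = (1 - l) * el v x + l * el v y" for v l x y
    by (simp add: el_def dev_mix add_divide_distrib)
  have el_centroid: "el v centroid = 0" for v by (simp add: el_def)
  have el_m [measurable]: "el v \<in> borel_measurable (lborel_Rn n)" for v
    unfolding el_def[abs_def] by measurable
  have Q_iff: "x \<in> polyh n F' \<longleftrightarrow> x \<in> Rn n \<and> (\<forall>v\<in>F'. el v x \<le> 1)" if "F' \<subseteq> F" for x F'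
  proof -
    have "inner_Rn n x v \<le> 1 \<longleftrightarrow> el v x \<le> 1" if "v \<in> F'" for v
      using gap_pos[of v] that \<open>F' \<subseteq> F\<close> unfolding inner_le_1_iff el_def
      by (subst pos_divide_le_eq) auto
    then show ?thesis unfolding polyh_def by blast
  qed
  \<comment> \<open>Strict inequalities make these sets disjoint; ties are lost, but only an upper
    bound on the sum of the volumes is needed.\<close>
  define D where "D j = {x\<in>Rn n. el j x \<le> 1 \<and> (\<forall>v\<in>F - {j}. el v x < el j x)}" for j
  have D_sub: "D j \<subseteq> ?Q" if "j \<in> F" for j
  proof
    fix x assume x: "x \<in> D j"
    have "el v x \<le> 1" if "v \<in> F" for v
      using x that by (cases "v = j") (auto simp: D_def intro: order_trans[OF less_imp_le])
    then show "x \<in> ?Q" using x Q_iff[OF order_refl] by (auto simp: D_def)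
  qed
  have D_sets [measurable]: "D j \<in> sets (lborel_Rn n)" for j
  proof -
    have "D j = {x\<in>space (lborel_Rn n). el j x \<le> 1} \<inter>
        (space (lborel_Rn n) - (\<Union>v\<in>F - {j}. {x\<in>space (lborel_Rn n). el j x \<le> el v x}))"
      unfolding D_def space_lborel_Rn not_le[symmetric] by blast
    also have "\<dots> \<in> sets (lborel_Rn n)"
      using finite_F by (intro sets.Int sets.Diff sets.top sets.finite_UN) (auto; measurable)+
    finally show ?thesis .
  qed
  have "(\<Sum>j\<in>F. \<mu> (D j)) = \<mu> (\<Union>j\<in>F. D j)"
  proof (rule measure_finite_Union[symmetric])
    show "disjoint_family_on D F"
      unfolding disjoint_family_on_def
    proof (intro ballI impI)
      fix m k assume mk: "m \<in> F" "k \<in> F" "m \<noteq> k"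
      have False if "x \<in> D m" "x \<in> D k" for x
      proof -
        have "el k x < el m x" "el m x < el k x" using that mk by (auto simp: D_def)
        then show False by simp
      qed
      then show "D m \<inter> D k = {}" by blast
    qed
    show "emeasure (lborel_Rn n) (D j) \<noteq> \<infinity>" if "j \<in> F" for j
      using vol_subset_eq[OF D_sub[OF that] D_sets] by (simp add: vol_def)
  qed (use finite_F in auto)
  also have "\<dots> \<le> V"
    unfolding V_def
  proof (rule measure_mono_fmeasurable)
    show "(\<Union>j\<in>F. D j) \<in> sets (lborel_Rn n)"
      using finite_F by (intro sets.finite_UN D_sets)
    show "?Q \<in> fmeasurable (lborel_Rn n)"
      using vol_finite by (auto simp: fmeasurable_def vol_def)
  qed (use D_sub in blast)
  finally have sumD: "(\<Sum>j\<in>F. \<mu> (D j)) \<le> V" .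
  obtain j where j: "j \<in> F" "\<mu> (D j) \<le> V / N"
  proof (rule ccontr)
    assume "\<not> thesis"
    then have "\<And>j. j \<in> F \<Longrightarrow> V / N < \<mu> (D j)" using that by (meson not_le)
    moreover have "F \<noteq> {}" using N0 by (auto simp: N_def)
    ultimately have "(\<Sum>j\<in>F. V / N) < (\<Sum>j\<in>F. \<mu> (D j))"
      using finite_F by (intro sum_strict_mono) auto
    then show False using sumD N0 by (simp add: N_def)
  qed
  \<comment> \<open>This width keeps \<open>(1 + h) ^ n\<close> below \<open>exp 1 \<le> 3\<close>,
    and \<open>2 * n\<close> steps of it lead from level -1 to level 1.\<close>
  define h where "h = 1 / real n"
  have h: "h > 0" using n by (simp add: h_def)
  define S where "S = {x\<in>Rn n. 1 < el j x \<and> el j x \<le> 1 + h \<and> (\<forall>v\<in>F - {j}. el v x < el j x)}"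
  have S_sets [measurable]: "S \<in> sets (lborel_Rn n)"
  proof -
    have "S = {x\<in>space (lborel_Rn n). 1 < el j x \<and> el j x \<le> 1 + h} \<inter>
        (space (lborel_Rn n) - (\<Union>v\<in>F - {j}. {x\<in>space (lborel_Rn n). el j x \<le> el v x}))"
      unfolding S_def space_lborel_Rn not_le[symmetric] by blast
    also have "\<dots> \<in> sets (lborel_Rn n)"
      using finite_F by (intro sets.Int sets.Diff sets.top sets.finite_UN) (auto; measurable)+
    finally show ?thesis .
  qed
  have volD: "vol n (D j) = ennreal (\<mu> (D j))" using j D_sub by (intro vol_subset_eq) auto
  have S_small: "vol n S \<le> ennreal (2 * V / N)"
  proof -
    \<comment> \<open>Shrinking towards the centroid multiplies all levels by
      \<open>1 / (1 + h)\<close>. This preserves their order and brings \<open>1 + h\<close> down to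
      1, so both \<open>D j\<close> and S land in \<open>D j\<close>.\<close>
    have "ennreal ((1 / (1 + h)) ^ n) * vol n (D j \<union> S) \<le> vol n (D j)"
    proof (rule vol_mix_le[OF _ D_sets, where z = centroid])
      fix x assume x: "x \<in> D j \<union> S"
      have "el j x \<le> 1 + h" "\<forall>v\<in>F - {j}. el v x < el j x"
        using x h by (auto simp: D_def S_def)
      then show "mix n (1 / (1 + h)) centroid x \<in> D j"
        using h by (auto simp: D_def el_mix el_centroid divide_strict_right_mono)
    qed (use h in \<open>auto simp: D_def S_def\<close>)
    then have "ennreal ((1 + h) ^ n) * (ennreal ((1 / (1 + h)) ^ n) * vol n (D j \<union> S))
        \<le> ennreal ((1 + h) ^ n) * vol n (D j)"
      by (rule mult_left_mono) simp
    moreover have "ennreal ((1 + h) ^ n) * ennreal ((1 / (1 + h)) ^ n) = 1"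
      using h by (subst ennreal_mult[symmetric]) (auto simp: power_divide)
    ultimately have "vol n (D j \<union> S) \<le> ennreal ((1 + h) ^ n) * vol n (D j)"
      by (simp add: mult.assoc[symmetric])
    also have "\<dots> = ennreal ((1 + h) ^ n * \<mu> (D j))"
      using h by (simp add: volD ennreal_mult)
    also have "\<dots> \<le> ennreal (3 * \<mu> (D j))"
    proof (intro ennreal_leI mult_right_mono)
      have "(1 + 1 / real n) ^ n \<le> exp 1"
        using n by (intro exp_ge_one_plus_x_over_n_power_n) auto
      also have "\<dots> \<le> 3" by (rule exp_le)
      finally show "(1 + h) ^ n \<le> 3" by (simp add: h_def)
    qed simp
    finally have 1: "vol n (D j \<union> S) \<le> ennreal (3 * \<mu> (D j))" .
    have "vol n (D j \<union> S) = vol n (D j) + vol n S"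
      unfolding vol_def
    proof (rule plus_emeasure[OF D_sets S_sets, symmetric])
      show "D j \<inter> S = {}" by (auto simp: D_def S_def)
    qed
    with 1 have "ennreal (\<mu> (D j)) + vol n S \<le> ennreal (\<mu> (D j)) + ennreal (2 * \<mu> (D j))"
      by (simp add: volD flip: ennreal_plus)
    then have "vol n S \<le> ennreal (2 * \<mu> (D j))" by simp
    also have "\<dots> \<le> ennreal (2 * V / N)" using j by (intro ennreal_leI) simp
    finally show ?thesis .
  qed
  show thesis
  proof (rule that[OF j(1)])
    fix T assume T: "?Q \<subseteq> Box n T"
    define QT where "QT = polyh n (F - {j}) \<inter> Box n T"
    have QT_sets [measurable]: "QT \<in> sets (lborel_Rn n)" by (simp add: QT_def)
    have QQT: "?Q \<subseteq> QT" using T polyh_antimono[of "F - {j}" F n] by (auto simp: QT_def)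
    have "vol n ?Q \<le> vol n QT" unfolding vol_def using QQT by (intro emeasure_mono) auto
    then interpret T: convex_body n QT T
      using vol_pos QT_sets convex_Int[OF convex_polyh convex_Box]
      by unfold_locales (auto simp: QT_def)
    define G where "G u = \<mu> {x\<in>QT. u < el j x}" for u
    have setsG: "{x\<in>QT. u < el j x} \<in> sets (lborel_Rn n)" for u
      by (rule T.sets_Collect_Q) measurable
    have sub: "G (b + u + w) * G b \<le> G (b + u) * G (b + w)" if "u \<ge> 0" "w \<ge> 0" for b u w
      unfolding G_def
      by (rule tail_submultiplicative[OF QT_sets T.Q_Box T.convex_Q el_m el_mix that])
    have fmQT: "A \<in> fmeasurable (lborel_Rn n)" if "A \<in> sets (lborel_Rn n)" "A \<subseteq> QT" for A
      using T.vol_subset_eq[OF that(2,1)] that by (simp add: fmeasurable_def vol_def)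
    define g where "g = G 1"
    have g0: "0 \<le> g" by (simp add: g_def G_def)
    have el_le1: "el j x \<le> 1" if "x \<in> ?Q" for x using that j by (simp add: Q_iff)
    have QT_split: "\<mu> QT \<le> V + g"
    proof -
      have "QT \<subseteq> ?Q \<union> {x\<in>QT. 1 < el j x}"
      proof
        fix x assume x: "x \<in> QT"
        then have "x \<in> Rn n" "\<forall>v\<in>F - {j}. el v x \<le> 1"
          using Q_iff[of "F - {j}" x] by (auto simp: QT_def)
        then show "x \<in> ?Q \<union> {x\<in>QT. 1 < el j x}"
          using x by (cases "el j x \<le> 1") (auto simp: Q_iff)
      qed
      then have "\<mu> QT \<le> \<mu> (?Q \<union> {x\<in>QT. 1 < el j x})"
        using setsG QQT by (intro measure_mono_fmeasurable fmQT) auto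
      also have "\<dots> \<le> V + g"
        unfolding V_def g_def G_def using setsG by (intro measure_Un_le) auto
      finally show ?thesis .
    qed
    have Gm1_le: "G u \<le> \<mu> QT" for u
      unfolding G_def using setsG by (intro measure_mono_fmeasurable fmQT) auto
    \<comment> \<open>On the polyhedron \<open>1 - el j\<close> is nonnegative with mean 1, so by
      Markov at least half of the volume lies above level -1; the region beyond the facet adds
      g.\<close>
    have Gm1_ge: "g + V / 2 \<le> G (-1)"
    proof -
      have el_int: "integrable U (el j)"
        unfolding el_def[abs_def] using integrable_dev by simp
      have "expectation (el j) = 0"
        unfolding el_def[abs_def] using expectation_dev by simp
      then have "expectation (\<lambda>x. 1 - el j x) = 1"
        using el_int by (simp add: prob_Q)
      moreover have "prob {x\<in>space U. 2 \<le> 1 - el j x} \<le> expectation (\<lambda>x. 1 - el j x) / 2"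
        using el_int el_le1 by (intro integral_Markov_inequality_measure[where A="{}"]) auto
      ultimately have 1: "prob {x\<in>space U. 2 \<le> 1 - el j x} \<le> 1 / 2" by simp
      have elU [measurable]: "el j \<in> borel_measurable U" by (rule measurable_U) measurable
      have "{x\<in>space U. 2 \<le> 1 - el j x} \<in> events" by measurable
      moreover have "{x\<in>?Q. -1 < el j x} = space U - {x\<in>space U. 2 \<le> 1 - el j x}" by auto
      ultimately have "prob {x\<in>?Q. -1 < el j x} = 1 - prob {x\<in>space U. 2 \<le> 1 - el j x}"
        by (simp only: prob_compl)
      with 1 have "1 / 2 \<le> prob {x\<in>?Q. -1 < el j x}" by linarith
      moreover have sQ: "{x\<in>?Q. -1 < el j x} \<in> sets (lborel_Rn n)"
        by (intro sets_Collect_Q el_m)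
      ultimately have "V / 2 \<le> \<mu> {x\<in>?Q. -1 < el j x}"
        using V by (subst (asm) measure_U) (auto simp: V_def field_simps)
      moreover have "\<mu> {x\<in>QT. 1 < el j x} + \<mu> {x\<in>?Q. -1 < el j x} =
          \<mu> ({x\<in>QT. 1 < el j x} \<union> {x\<in>?Q. -1 < el j x})"
      proof (rule measure_Union[OF _ _ setsG sQ, symmetric])
        have "{x\<in>?Q. -1 < el j x} \<subseteq> QT" using QQT by auto
        then show "emeasure (lborel_Rn n) {x\<in>?Q. -1 < el j x} \<noteq> \<infinity>"
          using fmQT[OF sQ] by (auto simp: fmeasurable_def)
        show "emeasure (lborel_Rn n) {x\<in>QT. 1 < el j x} \<noteq> \<infinity>"
          using fmQT[OF setsG, of 1] by (auto simp: fmeasurable_def)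
        show "{x\<in>QT. 1 < el j x} \<inter> {x\<in>?Q. -1 < el j x} = {}"
          using el_le1 by (force simp: not_less[symmetric])
      qed
      moreover have "\<dots> \<le> G (-1)"
        unfolding G_def using setsG sQ QQT by (intro measure_mono_fmeasurable fmQT) auto
      ultimately show ?thesis by (simp add: g_def G_def)
    qed
    \<comment> \<open>At levels in \<open>(1, 1 + h]\<close> the remaining constraints give
      \<open>el v \<le> 1 < el j\<close>, so such points lie in S.\<close>
    have slab: "g - G (1 + h) \<le> 2 * V / N"
    proof -
      have SQT: "{x\<in>QT. 1 < el j x} - {x\<in>QT. 1 + h < el j x} \<subseteq> S"
      proof
        fix x assume x: "x \<in> {x\<in>QT. 1 < el j x} - {x\<in>QT. 1 + h < el j x}"
        then have "x \<in> Rn n" "\<forall>v\<in>F - {j}. el v x \<le> 1"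
          using Q_iff[of "F - {j}" x] by (auto simp: QT_def)
        then show "x \<in> S" using x by (force simp: S_def)
      qed
      have "g - G (1 + h) = \<mu> ({x\<in>QT. 1 < el j x} - {x\<in>QT. 1 + h < el j x})"
        unfolding g_def G_def
      proof (rule measure_Diff[OF _ setsG setsG, symmetric])
        show "emeasure (lborel_Rn n) {x\<in>QT. 1 < el j x} \<noteq> \<infinity>"
          using fmQT[OF setsG, of 1] by (auto simp: fmeasurable_def)
      qed (use h in auto)
      also have "\<dots> \<le> \<mu> S"
        using SQT setsG S_small by (intro measure_mono_fmeasurable)
          (auto simp: fmeasurable_def vol_def less_top[symmetric] top_unique)
      also have "\<dots> \<le> 2 * V / N"
        using S_small V N0 by (simp add: vol_def measure_def enn2real_leI)
      finally show ?thesis .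
    qed
    \<comment> \<open>The four-point inequality for the levels \<open>?b\<close>,
      \<open>?b + h\<close>, \<open>1\<close>, \<open>1 + h\<close>: the relative loss of G over one
      step is at most that over the slab.\<close>
    have step: "g * G (-1 + real k * h) - g * G (-1 + real (Suc k) * h) \<le> (2 * V / N) * (V + g)"
      if k: "k < 2 * n" for k
    proof -
      let ?b = "-1 + real k * h"
      have "real k * h \<le> 2"
        using k n by (simp add: h_def field_simps)
      then have "G (1 + h) * G ?b \<le> g * G (?b + h)"
        using sub[of "1 - ?b" h ?b] h by (simp add: g_def)
      then have "g * G ?b - g * G (?b + h) \<le> (g - G (1 + h)) * G ?b"
        by (simp add: algebra_simps)
      also have "\<dots> \<le> (2 * V / N) * (V + g)"
        using slab V N0 Gm1_le[of ?b] QT_split g0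
        by (intro mult_mono) (auto simp: G_def)
      finally show ?thesis by (simp add: algebra_simps)
    qed
    have "g * G (-1) - g * G 1 = (\<Sum>k<2 * n. g * G (-1 + real k * h) - g * G (-1 + real (Suc k) * h))"
      using n by (subst sum_lessThan_telescope') (simp add: h_def)
    also have "\<dots> \<le> (\<Sum>k<2 * n. (2 * V / N) * (V + g))"
      using step by (intro sum_mono) auto
    also have "\<dots> = 4 * real n * V / N * (V + g)" by simp
    finally have "g * (G (-1) - g) \<le> 4 * real n * V / N * (V + g)"
      by (simp add: g_def algebra_simps)
    \<comment> \<open>Against the telescoped bound this yields
      \<open>g \<le> 8 * n / N * (V + g)\<close>, the source of the constant 8.\<close>
    moreover have "g * (V / 2) \<le> g * (G (-1) - g)" using Gm1_ge g0 by (intro mult_left_mono) auto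
    moreover have "V * (8 * real n / N * (V + g)) = 2 * (4 * real n * V / N * (V + g))"
      by (simp add: algebra_simps)
    moreover have "V * g = 2 * (g * (V / 2))" by simp
    ultimately have "V * g \<le> V * (8 * real n / N * (V + g))" by linarith
    then have "g \<le> 8 * real n / N * (V + g)" using V by (simp only: mult_le_cancel_left_pos)
    then have "(V + g) * (N - 8 * real n) \<le> V * N" using N0 by (simp add: field_simps)
    then have "V + g \<le> N / (N - 8 * real n) * V" using N8 by (simp add: pos_le_divide_eq mult.commute)
    then have "ennreal (\<mu> QT) \<le> ennreal (N / (N - 8 * real n) * V)"
      using QT_split by (intro ennreal_leI) linarith
    then show "vol n (polyh n (F - {j}) \<inter> Box n T)
       \<le> ennreal (real (card F) / (real (card F) - 8 * real n) * \<mu> ?Q)"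
      using T.vol_Q by (simp add: QT_def N_def V_def)
  qed
qed

text \<open>The truncated bound does not depend on T, so it passes to the limit of growing boxes;
  \<open>max R\<close> keeps \<open>polyh n F\<close> inside each of them.\<close>

lemma removal:
  assumes n: "n \<ge> 1" and N: "8 * real n < real (card F)"
  obtains j where "j \<in> F" "vol n (polyh n (F - {j}))
     \<le> ennreal (real (card F) / (real (card F) - 8 * real n) * \<mu> (polyh n F))"
proof -
  obtain j where j: "j \<in> F" "\<And>T. polyh n F \<subseteq> Box n T \<Longrightarrow> vol n (polyh n (F - {j}) \<inter> Box n T)
       \<le> ennreal (real (card F) / (real (card F) - 8 * real n) * \<mu> (polyh n F))"
    using truncated_removal[OF n N] by blast
  let ?A = "\<lambda>k. polyh n (F - {j}) \<inter> Box n (max R (real k))"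
  have "polyh n (F - {j}) = (\<Union>k. ?A k)"
  proof -
    have "Rn n \<subseteq> (\<Union>k. Box n (max R (real k)))"
      unfolding UN_Box[symmetric] by (intro UN_mono Box_mono) auto
    then have "polyh n (F - {j}) \<inter> (\<Union>k. Box n (max R (real k))) = polyh n (F - {j})"
      using polyh_subset_Rn by (intro Int_absorb2) (rule order_trans)
    then show ?thesis by (simp only: Int_UN_distrib)
  qed
  also have "vol n \<dots> = (SUP k. vol n (?A k))"
    unfolding vol_def
  proof (rule SUP_emeasure_incseq[symmetric])
    show "incseq ?A" unfolding incseq_def by (intro allI impI Int_mono Box_mono order_refl) auto
  qed auto
  also have "\<dots> \<le> ennreal (real (card F) / (real (card F) - 8 * real n) * \<mu> (polyh n F))"
    using Q_Box Box_mono[of R "max R (real _)" n] by (intro SUP_least j(2)) (meson max.cobounded1 order_trans)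
  finally show thesis using that j(1) by blast
qed

end

section \<open>Sparse subfamilies\<close>

lemma polyhedral_body_of_finite_vol:
  assumes "finite F" "0 < vol n (polyh n F)" "vol n (polyh n F) < \<infinity>"
  obtains R where "polyhedral_body n F R"
proof -
  obtain R where "polyh n F \<subseteq> Box n R"
    using convex_finite_vol_bounded[OF sets_polyh convex_polyh origin_in_polyh assms(2,3)] by blast
  then have "polyhedral_body n F R"
    using assms convex_polyh by unfold_locales auto
  then show thesis by (rule that)
qed

text \<open>While more than \<open>s \<ge> 8 * n\<close> half-spaces are left,
  \<open>removal\<close> drops one and keeps the volume finite.\<close>

lemma finite_vol_subfamily:
  assumes n: "n \<ge> 1" and s: "8 * real n \<le> real s"
    and F: "finite F" "F \<subseteq> V" "vol n (polyh n F) < \<infinity>" and vol: "0 < vol n (polyh n V)"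
  shows "\<exists>F'. finite F' \<and> F' \<subseteq> V \<and> card F' \<le> s \<and> vol n (polyh n F') < \<infinity>"
  using F
proof (induction "card F" arbitrary: F rule: less_induct)
  case less
  show ?case
  proof (cases "card F \<le> s")
    case True
    then show ?thesis using less.prems by blast
  next
    case False
    have "vol n (polyh n V) \<le> vol n (polyh n F)"
      unfolding vol_def using polyh_antimono[OF less.prems(2)] by (intro emeasure_mono) auto
    then have "0 < vol n (polyh n F)" using vol by (rule less_le_trans[rotated])
    then obtain R where "polyhedral_body n F R"
      using polyhedral_body_of_finite_vol less.prems by blast
    then interpret polyhedral_body n F R .
    have "8 * real n < real (card F)" using False s by linarith
    then obtain j where j: "j \<in> F" "vol n (polyh n (F - {j}))
       \<le> ennreal (real (card F) / (real (card F) - 8 * real n) * \<mu> (polyh n F))"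
      using removal[OF n] by blast
    have "card (F - {j}) < card F" using j less.prems(1) by (intro psubset_card_mono) auto
    moreover have "vol n (polyh n (F - {j})) < \<infinity>" using j(2) by (rule le_less_trans) simp
    ultimately show ?thesis using less.hyps[of "F - {j}"] less.prems by blast
  qed
qed

lemma sparse_subfamily_vol_le:
  assumes n: "n \<ge> 1" and s: "200 * real n \<le> real s" and vol1: "vol n (polyh n V) = 1"
  defines "\<theta> \<equiv> 8 * real n / (real s - 8 * real n)"
  obtains F where "finite F" "F \<subseteq> V" "card F \<le> s"
    "vol n (polyh n F) \<le> ennreal ((real n + 1) * (sqrt (1 + 40 * \<theta>) * sqrt (real n + 1)) ^ n)"
proof -
  have sn: "192 * real n \<le> real s - 8 * real n" "0 < real s - 8 * real n" using s n by auto
  \<comment> \<open>Since \<open>8 / 192 = 1 / 24\<close>, the cut share \<open>2 * \<theta>\<close>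
    meets the threshold 1/12 of \<open>cut_second_moment\<close>.\<close>
  have \<theta>: "0 < \<theta>" "\<theta> \<le> 1 / 24" using sn n by (auto simp: \<theta>_def pos_divide_le_eq)
  \<comment> \<open>Finiteness of the volume is included so that the infimum below is taken over
    genuine real volumes.\<close>
  define good where "good F \<longleftrightarrow> finite F \<and> F \<subseteq> V \<and> card F \<le> s \<and> vol n (polyh n F) < \<infinity>" for F
  define m where "m F = measure (lborel_Rn n) (polyh n F)" for F
  have vol_ge1: "1 \<le> vol n (polyh n F)" if "F \<subseteq> V" for F
    unfolding vol1[symmetric] vol_def using polyh_antimono[OF that] by (intro emeasure_mono) auto
  have vol_m: "vol n (polyh n F) = ennreal (m F)" if "good F" for F
    using that by (simp add: good_def vol_def m_def emeasure_eq_ennreal_measure less_top[symmetric])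
  have m_ge1: "1 \<le> m F" if "good F" for F
    using vol_ge1[of F] vol_m[OF that] that by (simp add: good_def)
  obtain F0 R0 where F0: "finite F0" "F0 \<subseteq> V" "polyh n F0 \<subseteq> Box n R0"
    using polyh_finite_subfamily_bounded[of n V] vol1 by auto
  have "vol n (polyh n F0) \<le> vol n (Box n R0)" unfolding vol_def using F0 by (intro emeasure_mono) auto
  then have "vol n (polyh n F0) < \<infinity>"
    using emeasure_Box_finite[of n R0] by (simp add: vol_def le_less_trans)
  then have "\<exists>F. good F"
    using finite_vol_subfamily[OF n _ F0(1,2), of s] s vol1 unfolding good_def by auto
  define I where "I = (INF F\<in>{F. good F}. m F)"
  have bdd: "bdd_below (m ` {F. good F})" using m_ge1 by (intro bdd_belowI2[of _ 1]) auto
  have I_le: "I \<le> m F" if "good F" for F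
    unfolding I_def using that bdd by (intro cINF_lower) auto
  have I1: "1 \<le> I" unfolding I_def using \<open>\<exists>F. good F\<close> m_ge1 by (intro cINF_greatest) auto
  \<comment> \<open>The infimum need not be attained; the slack is chosen equal to the loss in one
    removal.\<close>
  have "I < I * (1 + \<theta>)" using I1 \<theta> by simp
  moreover have "{F. good F} \<noteq> {}" using \<open>\<exists>F. good F\<close> by auto
  ultimately obtain F where F: "good F" "m F < I * (1 + \<theta>)"
    using cINF_less_iff[OF _ bdd, of "I * (1 + \<theta>)"] unfolding I_def by auto
  have body: "\<exists>R. polyhedral_body n F R" if "good F" for F
  proof -
    have "0 < vol n (polyh n F)" using vol_ge1[of F] that
      by (auto simp: good_def intro: less_le_trans[of 0 1])
    then show ?thesis using polyhedral_body_of_finite_vol[of F n] that by (auto simp: good_def)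
  qed
  \<comment> \<open>\<open>F'\<close> keeps room for one more half-space, so that every
    \<open>insert v F'\<close> with v in V competes in the infimum and has volume at least
    I.\<close>
  obtain F' where F': "good F'" "card F' < s" "m F' \<le> (1 + \<theta>) * m F"
  proof (cases "card F < s")
    case True
    have "m F \<le> (1 + \<theta>) * m F" using m_ge1[OF F(1)] \<theta> by simp
    with True F(1) that show thesis by blast
  next
    case False
    then have c: "card F = s" using F by (simp add: good_def)
    obtain R where "polyhedral_body n F R" using body[OF F(1)] by blast
    then interpret polyhedral_body n F R .
    obtain j where j: "j \<in> F" "vol n (polyh n (F - {j}))
       \<le> ennreal (real (card F) / (real (card F) - 8 * real n) * \<mu> (polyh n F))"
      using removal[OF n] sn c by auto
    have "card (F - {j}) < card F" using j finite_F by (intro psubset_card_mono) auto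
    moreover have "vol n (polyh n (F - {j})) < \<infinity>" using j(2) by (rule le_less_trans) simp
    ultimately have g: "good (F - {j})" using F(1) by (auto simp: good_def)
    have "real (card F) / (real (card F) - 8 * real n) = 1 + \<theta>"
      using sn by (simp add: c \<theta>_def field_simps)
    then have "ennreal (m (F - {j})) \<le> ennreal ((1 + \<theta>) * m F)"
      using j(2) vol_m[OF g] by (simp add: m_def)
    then have "m (F - {j}) \<le> (1 + \<theta>) * m F"
      using \<theta> m_ge1[OF F(1)] by (subst (asm) ennreal_le_iff) auto
    with g \<open>card (F - {j}) < card F\<close> c show thesis by (intro that[of "F - {j}"]) auto
  qed
  obtain R where "polyhedral_body n F' R" using body[OF F'(1)] by blast
  then interpret polyhedral_body n F' R .
  have mF': "m F' \<le> (1 + \<theta>)\<^sup>2 * I"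
  proof -
    have "m F' \<le> (1 + \<theta>) * (I * (1 + \<theta>))"
      using F' F(2) \<theta> mult_left_mono[of "m F" "I * (1 + \<theta>)" "1 + \<theta>"] by linarith
    then show ?thesis by (simp add: power2_eq_square algebra_simps)
  qed
  have cut: "\<mu> {x\<in>polyh n F'. 1 < inner_Rn n x v} \<le> (2 * \<theta>) * \<mu> (polyh n F')" if v: "v \<in> V" for v
  proof -
    have sub: "polyh n (insert v F') \<subseteq> polyh n F'" by (rule polyh_antimono) auto
    have "vol n (polyh n (insert v F')) \<le> vol n (polyh n F')"
      unfolding vol_def using sub by (intro emeasure_mono) auto
    then have "good (insert v F')"
      using F'(1,2) v by (auto simp: good_def card_insert_if intro: le_less_trans)
    then have "I \<le> m (insert v F')" by (rule I_le)
    have "\<mu> (polyh n F' - polyh n (insert v F')) = m F' - m (insert v F')"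
      unfolding m_def
    proof (rule measure_Diff)
      show "emeasure (lborel_Rn n) (polyh n F') \<noteq> \<infinity>" using vol_finite by (simp add: vol_def)
    qed (use sub in auto)
    moreover have "{x\<in>polyh n F'. 1 < inner_Rn n x v} = polyh n F' - polyh n (insert v F')"
      by (auto simp: polyh_def not_le)
    ultimately have "\<mu> {x\<in>polyh n F'. 1 < inner_Rn n x v} \<le> m F' - I"
      using \<open>I \<le> m (insert v F')\<close> by simp
    \<comment> \<open>Because \<open>(1 - 2 * \<theta>) * (1 + \<theta>) ^ 2 \<le> 1\<close>, the
      cut-off volume \<open>m F' - I\<close> is at most \<open>2 * \<theta> * m F'\<close>.\<close>
    moreover have "(1 - 2 * \<theta>) * m F' \<le> I"
    proof -
      have "(1 - 2 * \<theta>) * m F' \<le> (1 - 2 * \<theta>) * ((1 + \<theta>)\<^sup>2 * I)"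
        using mF' \<theta> by (intro mult_left_mono) auto
      also have "\<dots> = (1 - (3 * \<theta>\<^sup>2 + 2 * \<theta> ^ 3)) * I"
        by (simp add: power2_eq_square power3_eq_cube algebra_simps)
      also have "\<dots> \<le> 1 * I"
      proof (rule mult_right_mono)
        have "0 \<le> 3 * \<theta>\<^sup>2 + 2 * \<theta> ^ 3" using \<theta> by (intro add_nonneg_nonneg) auto
        then show "1 - (3 * \<theta>\<^sup>2 + 2 * \<theta> ^ 3) \<le> 1" by linarith
      qed (use I1 in linarith)
      finally show ?thesis by simp
    qed
    ultimately show ?thesis by (simp add: m_def algebra_simps)
  qed
  \<comment> \<open>The square root of \<open>1 + 20 * p\<close> at
    \<open>p = 2 * \<theta>\<close>.\<close>
  define L where "L = sqrt (1 + 40 * \<theta>)"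
  have L: "L > 0" "L\<^sup>2 = 1 + 20 * (2 * \<theta>)" using \<theta> by (auto simp: L_def)
  have p: "2 * \<theta> \<le> 1 / 12" using \<theta> by simp
  have "ennreal (\<mu> (polyh n F') / (real n + 1) / (L * sqrt (real n + 1)) ^ n) \<le> vol n (polyh n V)"
  proof (rule vol_le_of_second_moments[OF nondegenerate L(1)])
    fix v assume v: "v \<in> V"
    show "0 < gap v" by (rule cut_second_moment(1)[OF nondegenerate cut[OF v] p])
    show "expectation (\<lambda>x. (dev v x)\<^sup>2) \<le> L\<^sup>2 * (gap v)\<^sup>2"
      unfolding L(2) by (rule cut_second_moment(2)[OF nondegenerate cut[OF v] p])
  qed
  then have "\<mu> (polyh n F') / (real n + 1) / (L * sqrt (real n + 1)) ^ n \<le> 1"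
    by (simp add: vol1)
  then have "\<mu> (polyh n F') \<le> (real n + 1) * (L * sqrt (real n + 1)) ^ n"
    using L by (simp add: pos_divide_le_eq mult.commute)
  then have "vol n (polyh n F') \<le> ennreal ((real n + 1) * (L * sqrt (real n + 1)) ^ n)"
    unfolding vol_Q by (rule ennreal_leI)
  then show thesis using F'(1) by (intro that[of F']) (auto simp: good_def L_def)
qed

section \<open>Asymptotics and conclusion\<close>

text \<open>The sequence \<open>d\<close>. The second argument of \<open>max\<close> bounds the n-th
  root of the volume divided by \<open>n powr (3 / 2 - \<delta> / 2)\<close>; the maximum with 1
  gives positivity and the limit 1 also where that quotient tends to 0.\<close>

definition volume_factor :: "real \<Rightarrow> nat \<Rightarrow> real" where
  "volume_factor \<delta> n = max 1 ((real n + 1) powr (1 / real n) * sqrt (1 + 1 / real n) *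
     sqrt (1 + 2 * real n powr (1 - \<delta>)) * real n powr (\<delta> / 2 - 1))"

text \<open>For \<open>\<delta> = 2\<close> the second argument tends to 1. For
  \<open>\<delta> < 2\<close> it tends to 0 through its last power; the factor with
  \<open>1 - \<delta>\<close> is then only bounded by \<open>sqrt 3\<close>, which it equals for
  \<open>\<delta> = 1\<close> and \<open>n \<ge> 1\<close>.\<close>

lemma volume_factor_tendsto:
  assumes "1 \<le> \<delta>" "\<delta> \<le> 2"
  shows "volume_factor \<delta> \<longlonglongrightarrow> 1"
proof (cases "\<delta> = 2")
  case True
  have "volume_factor 2 \<longlonglongrightarrow> max 1 1"
    unfolding volume_factor_def[abs_def] by (rule tendsto_max[OF tendsto_const]) real_asymp
  then show ?thesis using True by simp
next
  case False
  with assms have d: "\<delta> / 2 - 1 < 0" by simp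
  let ?a = "\<lambda>n::nat. (real n + 1) powr (1 / real n) * sqrt (1 + 1 / real n)"
  let ?p = "\<lambda>n::nat. real n powr (\<delta> / 2 - 1)"
  let ?f = "\<lambda>n. ?a n * sqrt (1 + 2 * real n powr (1 - \<delta>)) * ?p n"
  have lim: "(\<lambda>n. ?a n * sqrt (1 + 2) * ?p n) \<longlonglongrightarrow> 0"
    using d by real_asymp
  have upper: "eventually (\<lambda>n. ?f n \<le> ?a n * sqrt (1 + 2) * ?p n) sequentially"
    using eventually_ge_at_top[of 1]
  proof eventually_elim
    case (elim n)
    have "real n powr (1 - \<delta>) \<le> real n powr 0" using elim assms by (intro powr_mono) auto
    then show ?case using elim by (intro mult_right_mono mult_left_mono) auto
  qed
  have lower: "eventually (\<lambda>n. 0 \<le> ?f n) sequentially"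
    by (intro always_eventually allI mult_nonneg_nonneg) auto
  have "?f \<longlonglongrightarrow> 0" by (rule tendsto_sandwich[OF lower upper tendsto_const lim])
  then have "volume_factor \<delta> \<longlonglongrightarrow> max 1 0"
    unfolding volume_factor_def[abs_def] by (rule tendsto_max[OF tendsto_const])
  then show ?thesis by simp
qed

lemma volume_factor_bound:
  assumes n: "n \<ge> 1" and d: "1 \<le> \<delta>" and s: "201 * real n powr \<delta> - 1 \<le> real s"
    and x: "x \<le> (real n + 1) * (sqrt (1 + 40 * (8 * real n / (real s - 8 * real n))) * sqrt (real n + 1)) ^ n"
    and x0: "0 \<le> x"
  shows "x powr (1 / real n) \<le> volume_factor \<delta> n * real n powr (3 / 2 - \<delta> / 2)"
proof -
  let ?k = "real n"
  have k: "?k \<ge> 1" using n by simp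
  have k\<delta>: "?k \<le> ?k powr \<delta>" using powr_mono[OF d k] k by simp
  \<comment> \<open>Here \<open>201 - 1 - 8 = 192\<close>, by
    \<open>1 \<le> n \<le> n powr \<delta>\<close>. The term with 40 is then at most
    \<open>40 / 24 * n powr (1 - \<delta>)\<close>, rounded up to the factor 2 of
    \<open>volume_factor\<close>.\<close>
  then have s1: "192 * ?k powr \<delta> \<le> real s - 8 * ?k" using s k by linarith
  have pos: "0 < ?k powr \<delta>" using k by simp
  have s8: "8 * ?k \<le> real s" using s1 pos by linarith
  have "8 * ?k / (real s - 8 * ?k) \<le> 8 * ?k / (192 * ?k powr \<delta>)"
    using s1 pos k by (intro divide_left_mono mult_pos_pos) linarith+
  also have "\<dots> = ?k powr (1 - \<delta>) / 24" using k by (simp add: powr_diff)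
  finally have "1 + 40 * (8 * ?k / (real s - 8 * ?k)) \<le> 1 + 2 * ?k powr (1 - \<delta>)"
    using powr_ge_zero[of ?k "1 - \<delta>"] by linarith
  then have "x \<le> (?k + 1) * (sqrt (1 + 2 * ?k powr (1 - \<delta>)) * sqrt (?k + 1)) ^ n"
    by (intro order_trans[OF x] mult_left_mono power_mono mult_right_mono) 
       (use s8 k in \<open>auto intro!: mult_nonneg_nonneg divide_nonneg_nonneg add_nonneg_nonneg\<close>)
  then have "x powr (1 / ?k) \<le> ((?k + 1) * (sqrt (1 + 2 * ?k powr (1 - \<delta>)) * sqrt (?k + 1)) ^ n) powr (1 / ?k)"
    using x0 by (intro powr_mono2) auto
  also have "\<dots> = (?k + 1) powr (1 / ?k) * (sqrt (1 + 2 * ?k powr (1 - \<delta>)) * sqrt (?k + 1))"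
  proof -
    have "(y ^ n) powr (1 / ?k) = y" if "y > 0" for y :: real
      using that n by (simp add: powr_realpow[symmetric] powr_powr)
    then show ?thesis by (simp add: powr_mult add_pos_nonneg)
  qed
  also have "sqrt (?k + 1) = sqrt (1 + 1 / ?k) * sqrt ?k"
    using k by (simp add: real_sqrt_mult[symmetric] distrib_right)
  \<comment> \<open>The exponents add up to 1/2, and the second one is that of the claimed
    bound.\<close>
  also have "sqrt ?k = ?k powr (\<delta> / 2 - 1) * ?k powr (3 / 2 - \<delta> / 2)"
    using k by (simp add: powr_half_sqrt[symmetric] powr_add[symmetric] diff_divide_distrib)
  finally have "x powr (1 / ?k) \<le> ((?k + 1) powr (1 / ?k) * sqrt (1 + 1 / ?k) *
      sqrt (1 + 2 * ?k powr (1 - \<delta>)) * ?k powr (\<delta> / 2 - 1)) * ?k powr (3 / 2 - \<delta> / 2)"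
    by (simp add: mult_ac)
  also have "\<dots> \<le> volume_factor \<delta> n * ?k powr (3 / 2 - \<delta> / 2)"
    unfolding volume_factor_def by (intro mult_right_mono) auto
  finally show ?thesis .
qed

theorem theorem1p3:
  "\<exists>\<alpha>>1::real. \<forall>\<delta>::real. 1 \<le> \<delta> \<and> \<delta> \<le> 2 \<longrightarrow>
     (\<exists>d :: nat \<Rightarrow> real. (\<forall>n. d n > 0) \<and> d \<longlonglongrightarrow> 1 \<and>
       (\<forall>n\<ge>1. \<forall>\<H> :: (nat \<Rightarrow> real) set set.
          (\<forall>H\<in>\<H>. \<exists>v\<in>Rn n. H = halfspace n v) \<longrightarrow>
          vol n (Rn n \<inter> \<Inter>\<H>) = 1 \<longrightarrow>
          (\<exists>(s :: nat) (H :: nat \<Rightarrow> (nat \<Rightarrow> real) set).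
             real s \<le> \<alpha> * real n powr \<delta> \<and>
             (\<forall>k\<in>{1..s}. H k \<in> \<H>) \<and>
             vol n (Rn n \<inter> (\<Inter>k\<in>{1..s}. H k)) < \<infinity> \<and>
             enn2real (vol n (Rn n \<inter> (\<Inter>k\<in>{1..s}. H k))) powr (1 / real n)
               \<le> d n * real n powr (3/2 - \<delta>/2))))"
proof (rule exI[of _ 201], intro conjI allI impI)
  fix \<delta> :: real assume \<delta>: "1 \<le> \<delta> \<and> \<delta> \<le> 2"
  show "\<exists>d :: nat \<Rightarrow> real. (\<forall>n. d n > 0) \<and> d \<longlonglongrightarrow> 1 \<and>
       (\<forall>n\<ge>1. \<forall>\<H> :: (nat \<Rightarrow> real) set set.
          (\<forall>H\<in>\<H>. \<exists>v\<in>Rn n. H = halfspace n v) \<longrightarrow>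
          vol n (Rn n \<inter> \<Inter>\<H>) = 1 \<longrightarrow>
          (\<exists>(s :: nat) (H :: nat \<Rightarrow> (nat \<Rightarrow> real) set).
             real s \<le> 201 * real n powr \<delta> \<and>
             (\<forall>k\<in>{1..s}. H k \<in> \<H>) \<and>
             vol n (Rn n \<inter> (\<Inter>k\<in>{1..s}. H k)) < \<infinity> \<and>
             enn2real (vol n (Rn n \<inter> (\<Inter>k\<in>{1..s}. H k))) powr (1 / real n)
               \<le> d n * real n powr (3/2 - \<delta>/2)))"
  proof (rule exI[of _ "volume_factor \<delta>"], intro conjI allI impI)
    show "volume_factor \<delta> n > 0" for n by (simp add: volume_factor_def less_max_iff_disj)
    show "volume_factor \<delta> \<longlonglongrightarrow> 1" using \<delta> volume_factor_tendsto by blast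
    fix n :: nat and \<H> :: "(nat \<Rightarrow> real) set set"
    assume n: "n \<ge> 1" and \<H>: "\<forall>H\<in>\<H>. \<exists>v\<in>Rn n. H = halfspace n v"
      and vol1: "vol n (Rn n \<inter> \<Inter>\<H>) = 1"
    define V where "V = {v \<in> Rn n. halfspace n v \<in> \<H>}"
    have "Rn n \<inter> \<Inter>\<H> = polyh n V"
    proof (intro equalityI subsetI)
      fix x assume "x \<in> Rn n \<inter> \<Inter>\<H>"
      then show "x \<in> polyh n V" by (auto simp: polyh_def V_def halfspace_def)
    next
      fix x assume x: "x \<in> polyh n V"
      have "x \<in> H" if H: "H \<in> \<H>" for H
      proof -
        obtain v where "v \<in> Rn n" "H = halfspace n v" using \<H> H by blast
        then show ?thesis using x H by (auto simp: polyh_def V_def halfspace_def)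
      qed
      then show "x \<in> Rn n \<inter> \<Inter>\<H>" using x polyh_subset_Rn by blast
    qed
    then have vol1: "vol n (polyh n V) = 1" using vol1 by simp
    \<comment> \<open>Rounding down loses less than 1, so the constant 201 leaves
      \<open>s \<ge> 200 * n\<close> as needed for \<open>sparse_subfamily_vol_le\<close>.\<close>
    define s where "s = nat \<lfloor>201 * real n powr \<delta>\<rfloor>"
    have k: "real n \<le> real n powr \<delta>" using powr_mono[of 1 \<delta> "real n"] \<delta> n by simp
    have s: "real s \<le> 201 * real n powr \<delta>" "201 * real n powr \<delta> - 1 \<le> real s"
      unfolding s_def by (auto simp: le_floor_iff)
    have "200 * real n \<le> real s" using s(2) k n by linarith
    from sparse_subfamily_vol_le[OF n this vol1]
    obtain F where F: "finite F" "F \<subseteq> V" "card F \<le> s"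
      and volF: "vol n (polyh n F) \<le> ennreal ((real n + 1) *
        (sqrt (1 + 40 * (8 * real n / (real s - 8 * real n))) * sqrt (real n + 1)) ^ n)" (is "_ \<le> ennreal ?b")
      by blast
    \<comment> \<open>The number of indices is the size of F, which may be smaller than s; for empty
      F the intersection is \<open>Rn n\<close>.\<close>
    obtain h where h: "bij_betw h {1..card F} F" using ex_bij_betw_nat_finite_1[OF F(1)] by blast
    define H where "H k = halfspace n (h k)" for k
    have eq: "Rn n \<inter> (\<Inter>k\<in>{1..card F}. H k) = polyh n F"
    proof -
      have "(\<forall>v\<in>F. P v) \<longleftrightarrow> (\<forall>k\<in>{1..card F}. P (h k))" for P
        unfolding ball_simps(9)[symmetric] bij_betw_imp_surj_on[OF h] by (rule refl)
      from this[of "\<lambda>v. inner_Rn n _ v \<le> 1"]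
      have "polyh n F = {x \<in> Rn n. \<forall>k\<in>{1..card F}. inner_Rn n x (h k) \<le> 1}"
        unfolding polyh_def by (rule Collect_cong[OF conj_cong[OF refl]])
      then show ?thesis by (auto simp: H_def halfspace_def)
    qed
    have b0: "0 \<le> ?b"
      using \<open>200 * real n \<le> real s\<close> by (intro mult_nonneg_nonneg zero_le_power) auto
    have "enn2real (vol n (polyh n F)) \<le> ?b"
      using b0 volF by (rule enn2real_leI)
    then have "enn2real (vol n (polyh n F)) powr (1 / real n) \<le> volume_factor \<delta> n * real n powr (3/2 - \<delta>/2)"
      using \<delta> s(2) by (intro volume_factor_bound[OF n]) auto
    \<comment> \<open>Stated separately because \<open>enn2real\<close> sends
      \<open>\<infinity>\<close> to 0.\<close>
    moreover have "vol n (polyh n F) < \<infinity>" using volF by (rule le_less_trans) simp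
    moreover have "H k \<in> \<H>" if "k \<in> {1..card F}" for k
      using bij_betw_apply[OF h that] F(2) by (auto simp: H_def V_def)
    moreover have "real (card F) \<le> 201 * real n powr \<delta>" using s F(3) by linarith
    ultimately show "\<exists>(s :: nat) (H :: nat \<Rightarrow> (nat \<Rightarrow> real) set).
             real s \<le> 201 * real n powr \<delta> \<and>
             (\<forall>k\<in>{1..s}. H k \<in> \<H>) \<and>
             vol n (Rn n \<inter> (\<Inter>k\<in>{1..s}. H k)) < \<infinity> \<and>
             enn2real (vol n (Rn n \<inter> (\<Inter>k\<in>{1..s}. H k))) powr (1 / real n)
               \<le> volume_factor \<delta> n * real n powr (3/2 - \<delta>/2)"
      using eq by (intro exI[of _ "card F"] exI[of _ H]) auto
  qed
qed simp

end
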